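(* Let $k\ge 2$ be a fixed integer and let $n_1,\ldots,n_k$ be positive integers with $n_k=\min_{1\le i\le k} n_i$. Let $G\sim\mathcal{T}(n_1,\ldots,n_k)$. Then, with probability $1-o(1)$ as $n_k\to\infty$, it holds that $f_k(G)=s(G)-k+1$.
   Context: $\mathcal{T}(n_1,\ldots,n_k)$ denotes the probability space of $k$-partite tournaments obtained from the complete $k$-partite graph with vertex classes $V_1,\ldots,V_k$, $|V_i|=n_i$, by orienting each edge independently and uniformly at random. For a $k$-partite tournament $G$, $s(G)$ denotes the size of its smallest vertex class (so $s(G)=n_k$ here). A feedback arc set of a directed graph $G$ is a set of edges meeting every directed cycle of $G$ (viewed as a spanning subgraph of $G$). For an oriented graph $G$, $f_k(G)$ is the maximum integer $t$ such that every feedback arc set of $G$ contains $t$ pairwise vertex-disjoint copies of the transitive tournament on $k$ vertices (i.e. of an acyclic $k$-clique). *)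

theory Defs
  imports "HOL-Probability.Probability"
begin

(* Vertices of the complete k-partite graph with classes V_0,...,V_{k-1},
   |V_i| = n i.  Vertex (i,j) is the j-th vertex of class i. *)
definition kp_vertices :: "nat \<Rightarrow> (nat \<Rightarrow> nat) \<Rightarrow> (nat \<times> nat) set" where
  "kp_vertices k n = {(i, j). i < k \<and> j < n i}"

definition kp_tournaments :: "nat \<Rightarrow> (nat \<Rightarrow> nat) \<Rightarrow> ((nat \<times> nat) \<times> (nat \<times> nat)) set set" where
  "kp_tournaments k n =
     {A. A \<subseteq> {(u, v). u \<in> kp_vertices k n \<and> v \<in> kp_vertices k n \<and> fst u \<noteq> fst v} \<and>
         (\<forall>u\<in>kp_vertices k n. \<forall>v\<in>kp_vertices k n. fst u \<noteq> fst v \<longrightarrow>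
              ((u, v) \<in> A \<longleftrightarrow> (v, u) \<notin> A))}"

(* Random k-partite tournament T(n_0,...,n_{k-1}): each edge oriented independently
   and uniformly, i.e. the uniform distribution on all orientations. *)
definition random_kp_tournament :: "nat \<Rightarrow> (nat \<Rightarrow> nat) \<Rightarrow> ((nat \<times> nat) \<times> (nat \<times> nat)) set pmf" where
  "random_kp_tournament k n = pmf_of_set (kp_tournaments k n)"

definition dir_cycle :: "('v \<times> 'v) set \<Rightarrow> 'v list \<Rightarrow> bool" where
  "dir_cycle A cs \<longleftrightarrow> length cs \<ge> 2 \<and> distinct cs \<and>
     (\<forall>i < length cs. (cs ! i, cs ! ((i + 1) mod length cs)) \<in> A)"

definition feedback_arc_set :: "('v \<times> 'v) set \<Rightarrow> ('v \<times> 'v) set \<Rightarrow> bool" where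
  "feedback_arc_set A F \<longleftrightarrow> F \<subseteq> A \<and>
     (\<forall>cs. dir_cycle A cs \<longrightarrow>
        (\<exists>i < length cs. (cs ! i, cs ! ((i + 1) mod length cs)) \<in> F))"

definition has_disjoint_TTs :: "nat \<Rightarrow> ('v \<times> 'v) set \<Rightarrow> nat \<Rightarrow> bool" where
  "has_disjoint_TTs k F t \<longleftrightarrow>
     (\<exists>c :: nat \<Rightarrow> nat \<Rightarrow> 'v.
        inj_on (\<lambda>(a, j). c a j) ({..<t} \<times> {..<k}) \<and>
        (\<forall>a < t. \<forall>j < k. \<forall>j' < k. j < j' \<longrightarrow> (c a j, c a j') \<in> F))"

definition f_TT :: "nat \<Rightarrow> ('v \<times> 'v) set \<Rightarrow> nat" where
  "f_TT k A = (GREATEST t. \<forall>F. feedback_arc_set A F \<longrightarrow> has_disjoint_TTs k F t)"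

end

theory Submission
  imports Defs
begin

text \<open>
  Upper bound: put k - 1 vertices of the smallest class in the middle of a linear order and every
  vertex of class i before or after them according to its edge with the i-th of these. Then the i-th
  one has no backward edge to class i, so none of them lies in a clique of backward edges.

  Lower bound: a feedback arc set contains all backward edges of some linear order. Keep only the
  first m vertices of each class, m being the size of the smallest class. With high probability
  there are no two sets of size a (a small power of m) in different classes with all edges directed
  from one to the other, and any two vertices have many directed paths of length two through any
  other class. The first property shows, for every linear order, that the graph of backward edges
  has no bipartite hole of size 2a; the second that at most one vertex has few backward edges to a
  given class, so that after deleting k - 1 vertices from each class all backward degrees are large.
  Such a graph has a perfect tiling by transversal cliques. This is proved by absorption: reserve a
  small set Z and give each transversal of Z an absorber; cover the few vertices with few
  neighbours in Z; tile greedily; cover the small rest using Z; absorb what remains of Z.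
\<close>

section \<open>Clique factors in multipartite graphs without holes\<close>

text \<open>The feedback arc set, and with it the linear order, is chosen after the tournament.
  Randomness may therefore enter only through properties that mention no order; once the two
  properties of the tournament hold, everything else is deterministic. The number k - 1 arises from
  both sides. Each class has at most one outside vertex with few backward edges to it, so a class
  loses at most one vertex on account of each of the k - 1 others; and the order of the upper bound
  makes k - 1 vertices of one class useless. A greedy tiling alone stops with up to
  \<open>clique_threshold k s - 1\<close> uncovered vertices in each class, whereas the sharp value
  s(G) - k + 1 admits no loss beyond the deleted vertices. This is what forces absorption. For fixed
  k all thresholds are polynomial in a, so a can be an integer root of m: large enough for m^(2a) /
  2^(a^2) to vanish, small enough for the thresholds to fit into m.\<close>

definition clique_threshold :: "nat \<Rightarrow> nat \<Rightarrow> nat" where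
  "clique_threshold k s = (k * s) ^ k"

text \<open>z is the size of the reserve in each class. T bounds what the reserve and its absorbers
  take from a class: z, plus k + 1 vertices for each of at most z ^ k transversals. The term k * ((T
  + k + c) * s) pays for the vertices to be avoided when an absorber is placed, and k * k * z bounds
  the vertices with few neighbours in the reserve.\<close>

definition factor_threshold :: "nat \<Rightarrow> nat \<Rightarrow> nat" where
  "factor_threshold k s = (let c = clique_threshold k s; z = (k + 1) * c * s; T = z + (k + 1) * z ^ k
     in T + k * ((T + k + c) * s) + c + k * k * z)"

locale holefree_multipartite =
  fixes k s :: nat and U :: "nat \<Rightarrow> 'v set" and B :: "'v \<Rightarrow> 'v \<Rightarrow> bool"
  assumes k_pos: "k \<ge> 1" and s_pos: "s \<ge> 1"
    and finite_U: "\<And>i. i < k \<Longrightarrow> finite (U i)"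
    and disjoint_U: "\<And>i j. i < k \<Longrightarrow> j < k \<Longrightarrow> i \<noteq> j \<Longrightarrow> U i \<inter> U j = {}"
    and B_sym: "\<And>x y. B x y \<Longrightarrow> B y x"
    and no_hole: "\<And>i j X Y. i < k \<Longrightarrow> j < k \<Longrightarrow> i \<noteq> j \<Longrightarrow> X \<subseteq> U i \<Longrightarrow> Y \<subseteq> U j \<Longrightarrow>
      card X = s \<Longrightarrow> card Y = s \<Longrightarrow> \<exists>x\<in>X. \<exists>y\<in>Y. B x y"
begin

section \<open>Transversal cliques, tilings and balanced sets\<close>

definition verts :: "'v set" where
  "verts = (\<Union>i<k. U i)"

definition nbrs :: "'v \<Rightarrow> 'v set \<Rightarrow> 'v set" where
  "nbrs x Y = {y \<in> Y. B x y}"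

definition transversal_clique :: "'v set \<Rightarrow> bool" where
  "transversal_clique K \<longleftrightarrow> (\<exists>f. K = f ` {..<k} \<and> (\<forall>i<k. f i \<in> U i) \<and>
     (\<forall>i<k. \<forall>j<k. i \<noteq> j \<longrightarrow> B (f i) (f j)))"

definition clique_factor :: "'v set set \<Rightarrow> 'v set \<Rightarrow> bool" where
  "clique_factor P S \<longleftrightarrow> finite P \<and> disjoint P \<and> \<Union>P = S \<and> (\<forall>K\<in>P. transversal_clique K)"

definition factorable :: "'v set \<Rightarrow> bool" where
  "factorable S \<longleftrightarrow> (\<exists>P. clique_factor P S)"

text \<open>The divisibility condition of the tiling problem: every tiled set satisfies it, and so
  does what a tiled set leaves of classes of equal size.\<close>

definition balanced :: "nat \<Rightarrow> 'v set \<Rightarrow> bool" where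
  "balanced t S \<longleftrightarrow> S \<subseteq> verts \<and> (\<forall>i<k. card (S \<inter> U i) = t)"

abbreviation cliq :: nat where
  "cliq \<equiv> clique_threshold k s"

lemma finite_verts: "finite verts"
  unfolding verts_def using finite_U by auto

lemma U_subset_verts: "i < k \<Longrightarrow> U i \<subseteq> verts"
  unfolding verts_def by auto

lemma nbrs_subset: "nbrs x Y \<subseteq> Y"
  unfolding nbrs_def by auto

lemma class_unique: "x \<in> U i \<Longrightarrow> x \<in> U j \<Longrightarrow> i < k \<Longrightarrow> j < k \<Longrightarrow> i = j"
  using disjoint_U by blast

lemma image_Int_class:
  assumes "\<And>i. i < k \<Longrightarrow> f i \<in> U i" "i < k"
  shows "f ` {..<k} \<inter> U i = {f i}"
  using assms class_unique by auto

lemma transversal_clique_balanced: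
  assumes "transversal_clique K" shows "balanced 1 K"
proof -
  from assms obtain f where f: "K = f ` {..<k}" "\<forall>i<k. f i \<in> U i"
    unfolding transversal_clique_def by blast
  then show ?thesis
    unfolding balanced_def verts_def using image_Int_class[of f] by auto
qed

lemma balanced_Un:
  assumes "balanced a S" "balanced b T" "S \<inter> T = {}"
  shows "balanced (a + b) (S \<union> T)"
  unfolding balanced_def
proof (intro conjI allI impI)
  show "S \<union> T \<subseteq> verts" using assms unfolding balanced_def by auto
  fix i assume i: "i < k"
  have "card ((S \<union> T) \<inter> U i) = card (S \<inter> U i \<union> T \<inter> U i)" by (simp add: Int_Un_distrib2)
  also have "\<dots> = card (S \<inter> U i) + card (T \<inter> U i)"
    using assms finite_U[OF i] by (intro card_Un_disjoint) auto
  finally show "card ((S \<union> T) \<inter> U i) = a + b" using assms i unfolding balanced_def by auto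
qed

lemma balanced_Diff:
  assumes "balanced a S" "balanced b T" "T \<subseteq> S"
  shows "balanced (a - b) (S - T)"
  unfolding balanced_def
proof (intro conjI allI impI)
  show "S - T \<subseteq> verts" using assms unfolding balanced_def by auto
  fix i assume i: "i < k"
  have "card ((S - T) \<inter> U i) = card (S \<inter> U i - T \<inter> U i)" by (rule arg_cong[of _ _ card]) auto
  also have "\<dots> = card (S \<inter> U i) - card (T \<inter> U i)"
    using assms finite_U[OF i] by (intro card_Diff_subset) auto
  finally show "card ((S - T) \<inter> U i) = a - b" using assms i unfolding balanced_def by auto
qed

lemma factorable_empty: "factorable {}"
  unfolding factorable_def clique_factor_def by (intro exI[of _ "{}"]) auto

lemma factorable_clique: "transversal_clique K \<Longrightarrow> factorable K"
  unfolding factorable_def clique_factor_def by (intro exI[of _ "{K}"]) auto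

lemma factorable_Un:
  assumes "factorable S" "factorable T" "S \<inter> T = {}"
  shows "factorable (S \<union> T)"
proof -
  from assms obtain P Q where "clique_factor P S" "clique_factor Q T"
    unfolding factorable_def by blast
  then have "clique_factor (P \<union> Q) (S \<union> T)"
    using assms(3) unfolding clique_factor_def
    by (auto intro!: disjoint_union)
  then show ?thesis unfolding factorable_def by blast
qed

lemma clique_factor_balanced:
  assumes "clique_factor P S" shows "balanced (card P) S"
proof -
  have "finite P" "disjoint P" "\<forall>K\<in>P. transversal_clique K" "\<Union>P = S"
    using assms unfolding clique_factor_def by auto
  then show ?thesis
  proof (induction P arbitrary: S rule: finite_induct)
    case empty
    then show ?case unfolding balanced_def by auto
  next
    case (insert K P)
    have d: "K \<inter> \<Union>P = {}"
      using insert.prems(1) insert.hyps(2) by (auto simp: disjoint_def pairwise_def disjnt_def)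
    have "disjoint P" using insert.prems(1) by (auto simp: pairwise_insert)
    then have "balanced (card P) (\<Union>P)" using insert by auto
    then have "balanced (1 + card P) (K \<union> \<Union>P)"
      using insert.prems d by (intro balanced_Un transversal_clique_balanced) auto
    then show ?case using insert by auto
  qed
qed

lemma factorable_balanced: "factorable S \<Longrightarrow> \<exists>t. balanced t S"
  unfolding factorable_def using clique_factor_balanced by blast

lemma factorable_subset: "factorable S \<Longrightarrow> S \<subseteq> verts"
  using factorable_balanced unfolding balanced_def by blast

section \<open>Finding cliques from the absence of holes\<close>

text \<open>Split s vertices off Y. Fewer than s vertices of class i miss all of them, since s such
  vertices would form a hole; every other vertex gains a neighbour there and can be poor only if it
  has fewer than q - 1 neighbours in the rest. So each unit of q costs s.\<close>

lemma few_poor_vertices: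
  assumes "i < k" "j < k" "i \<noteq> j" "Y \<subseteq> U j" "card Y \<ge> q * s"
  shows "card {x \<in> U i. card (nbrs x Y) < q} \<le> q * s"
  using assms(4,5)
proof (induction q arbitrary: Y)
  case 0
  then show ?case by auto
next
  case (Suc q)
  have fY: "finite Y" using Suc.prems(1) finite_U[OF assms(2)] finite_subset by blast
  have "s \<le> card Y" using Suc.prems by auto
  then obtain Y0 where Y0: "Y0 \<subseteq> Y" "card Y0 = s" "finite Y0"
    by (metis obtain_subset_with_card_n)
  define I0 where "I0 = {x \<in> U i. nbrs x Y0 = {}}"
  define I1 where "I1 = {x \<in> U i. card (nbrs x (Y - Y0)) < q}"
  have fin: "finite I0" "finite I1" using finite_U[OF assms(1)] by (auto simp: I0_def I1_def)
  have "card I0 < s"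
  proof (rule ccontr)
    assume "\<not> ?thesis"
    then obtain X where X: "X \<subseteq> I0" "card X = s" by (metis obtain_subset_with_card_n not_less)
    then have "\<exists>x\<in>X. \<exists>y\<in>Y0. B x y"
      using Y0 Suc.prems assms by (intro no_hole[of i j]) (auto simp: I0_def)
    then show False using X by (auto simp: I0_def nbrs_def)
  qed
  moreover have "card I1 \<le> q * s"
    unfolding I1_def using Y0 Suc.prems fY by (intro Suc.IH) (auto simp: card_Diff_subset)
  moreover have "{x \<in> U i. card (nbrs x Y) < Suc q} \<subseteq> I0 \<union> I1"
  proof
    fix x assume x: "x \<in> {x \<in> U i. card (nbrs x Y) < Suc q}"
    show "x \<in> I0 \<union> I1"
    proof (cases "nbrs x Y0 = {}")
      case True then show ?thesis using x by (auto simp: I0_def)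
    next
      case False
      have "nbrs x Y = nbrs x Y0 \<union> nbrs x (Y - Y0)" using Y0 by (auto simp: nbrs_def)
      then have "card (nbrs x Y) = card (nbrs x Y0) + card (nbrs x (Y - Y0))"
        using fY Y0 by (simp, intro card_Un_disjoint) (auto simp: nbrs_def)
      moreover have "card (nbrs x Y0) > 0"
        using False Y0 by (auto simp: card_gt_0_iff nbrs_def)
      ultimately show ?thesis using x by (auto simp: I1_def)
    qed
  qed
  then have "card {x \<in> U i. card (nbrs x Y) < Suc q} \<le> card (I0 \<union> I1)"
    using fin by (intro card_mono) auto
  moreover have "card (I0 \<union> I1) \<le> card I0 + card I1" by (rule card_Un_le)
  ultimately show ?case by simp
qed

text \<open>Choose a vertex of \<open>X p\<close> with many neighbours in every other
  \<open>X j\<close> and recurse into these neighbourhoods. With c the size required of the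
  neighbourhoods, each \<open>X j\<close> rules out at most c * s candidates and there are fewer
  than k of them, so k * s * c candidates suffice. This is where the factor k * s per class comes
  from.\<close>

lemma clique_in_large_sets_aux:
  assumes "finite I" "I \<subseteq> {..<k}" "\<And>i. i \<in> I \<Longrightarrow> X i \<subseteq> U i"
    "\<And>i. i \<in> I \<Longrightarrow> card (X i) \<ge> (k * s) ^ card I"
  shows "\<exists>f. \<forall>i\<in>I. f i \<in> X i \<and> (\<forall>j\<in>I. i \<noteq> j \<longrightarrow> B (f i) (f j))"
  using assms
proof (induction I arbitrary: X rule: finite_induct)
  case empty
  then show ?case by auto
next
  case (insert p I)
  define c where "c = (k * s) ^ card I"
  have c1: "c \<ge> 1" unfolding c_def using k_pos s_pos by simp
  have pk: "p < k" and Ik: "I \<subseteq> {..<k}" using insert.prems(1) by auto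
  have cI: "card I + 1 \<le> k"
    using card_mono[of "{..<k}" "insert p I"] insert.hyps insert.prems(1) by simp
  have big: "card (X i) \<ge> k * s * c" if "i \<in> insert p I" for i
    using insert.prems(3)[OF that] by (simp add: c_def insert.hyps(1,2))
  define Bad where "Bad j = {x \<in> U p. card (nbrs x (X j)) < c}" for j
  have cB: "card (Bad j) \<le> c * s" if "j \<in> I" for j
  proof -
    have "c * s \<le> k * s * c" using mult_le_mono1[OF k_pos, of "s * c"] by (simp add: ac_simps)
    also have "\<dots> \<le> card (X j)" using big[of j] that by simp
    finally have "c * s \<le> card (X j)" .
    then show ?thesis
      unfolding Bad_def using that insert.prems(2)[of j] insert.hyps(2) Ik pk
      by (intro few_poor_vertices[of p j]) auto
  qed
  have "\<not> X p \<subseteq> (\<Union>j\<in>I. Bad j)"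
  proof
    assume "X p \<subseteq> (\<Union>j\<in>I. Bad j)"
    then have "card (X p) \<le> card (\<Union>j\<in>I. Bad j)"
      using insert.hyps(1) finite_U[OF pk] by (intro card_mono) (auto simp: Bad_def)
    also have "\<dots> \<le> (\<Sum>j\<in>I. card (Bad j))" using insert.hyps(1) by (rule card_UN_le)
    also have "\<dots> \<le> (\<Sum>j\<in>I. c * s)" by (rule sum_mono[OF cB])
    also have "\<dots> = card I * (s * c)" by simp
    finally have "card (X p) \<le> card I * (s * c)" .
    moreover have "k * (s * c) \<le> card (X p)" using big[of p] by (simp add: mult.assoc)
    ultimately have "k * (s * c) \<le> card I * (s * c)" by (rule order_trans[rotated])
    then show False using cI c1 s_pos by auto
  qed
  then obtain x where x: "x \<in> X p" "\<And>j. j \<in> I \<Longrightarrow> x \<notin> Bad j" by blast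
  have "\<exists>f. \<forall>i\<in>I. f i \<in> nbrs x (X i) \<and> (\<forall>j\<in>I. i \<noteq> j \<longrightarrow> B (f i) (f j))"
  proof (rule insert.IH[OF Ik])
    show "nbrs x (X i) \<subseteq> U i" if "i \<in> I" for i
      using that insert.prems(2)[of i] nbrs_subset[of x "X i"] by auto
    show "(k * s) ^ card I \<le> card (nbrs x (X i))" if "i \<in> I" for i
    proof -
      have "x \<notin> Bad i" "x \<in> U p" using x that insert.prems(2)[of p] by auto
      then show ?thesis by (simp add: Bad_def c_def)
    qed
  qed
  then obtain f where f: "\<And>i. i \<in> I \<Longrightarrow> f i \<in> nbrs x (X i)"
    "\<And>i j. i \<in> I \<Longrightarrow> j \<in> I \<Longrightarrow> i \<noteq> j \<Longrightarrow> B (f i) (f j)" by blast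
  have fX: "f i \<in> X i" "B x (f i)" "B (f i) x" if "i \<in> I" for i
    using f(1)[OF that] B_sym by (auto simp: nbrs_def)
  show ?case
  proof (intro exI[of _ "f(p := x)"] ballI conjI impI)
    fix i j assume ij: "i \<in> insert p I" "j \<in> insert p I" "i \<noteq> j"
    then show "B ((f(p := x)) i) ((f(p := x)) j)"
      using f(2)[of i j] fX by (cases "i = p"; cases "j = p") auto
  qed (use fX x(1) in auto)
qed

lemma clique_in_large_sets:
  assumes "I \<subseteq> {..<k}" "\<And>i. i \<in> I \<Longrightarrow> X i \<subseteq> U i" "\<And>i. i \<in> I \<Longrightarrow> card (X i) \<ge> cliq"
  obtains f where "\<And>i. i \<in> I \<Longrightarrow> f i \<in> X i"
    "\<And>i j. i \<in> I \<Longrightarrow> j \<in> I \<Longrightarrow> i \<noteq> j \<Longrightarrow> B (f i) (f j)"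
proof -
  have "finite I" using assms(1) finite_subset by blast
  moreover have "(k * s) ^ card I \<le> cliq"
    unfolding clique_threshold_def using assms(1) k_pos s_pos card_mono[of "{..<k}" I]
    by (intro power_increasing) auto
  ultimately have "\<exists>f. \<forall>i\<in>I. f i \<in> X i \<and> (\<forall>j\<in>I. i \<noteq> j \<longrightarrow> B (f i) (f j))"
    using assms by (intro clique_in_large_sets_aux) (auto intro: order_trans)
  then show thesis using that by blast
qed

lemma transversal_clique_through:
  assumes "p < k" "x \<in> U p" "\<And>i. i \<in> {..<k} - {p} \<Longrightarrow> f i \<in> nbrs x (U i)"
    "\<And>i j. i \<in> {..<k} - {p} \<Longrightarrow> j \<in> {..<k} - {p} \<Longrightarrow> i \<noteq> j \<Longrightarrow> B (f i) (f j)"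
  shows "transversal_clique (insert x (f ` ({..<k} - {p})))"
  unfolding transversal_clique_def
proof (intro exI[of _ "f(p := x)"] conjI allI impI)
  show "insert x (f ` ({..<k} - {p})) = (f(p := x)) ` {..<k}" using assms(1) by auto
  fix i j assume ij: "i < k" "j < k" "i \<noteq> j"
  have "B x (f i)" "B (f i) x" if "i \<in> {..<k} - {p}" for i
    using assms(3)[OF that] B_sym by (auto simp: nbrs_def)
  then show "B ((f(p := x)) i) ((f(p := x)) j)"
    using assms(4)[of i j] ij by (cases "i = p"; cases "j = p") auto
qed (use assms in \<open>auto simp: nbrs_def\<close>)

lemma clique_through_vertex:
  assumes "p < k" "x \<in> U p"
    "\<And>i. i < k \<Longrightarrow> i \<noteq> p \<Longrightarrow> card (nbrs x (Y \<inter> U i)) \<ge> cliq"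
  obtains K where "transversal_clique K" "x \<in> K" "K \<subseteq> insert x Y"
proof -
  obtain f where f: "\<And>i. i \<in> {..<k} - {p} \<Longrightarrow> f i \<in> nbrs x (Y \<inter> U i)"
    "\<And>i j. i \<in> {..<k} - {p} \<Longrightarrow> j \<in> {..<k} - {p} \<Longrightarrow> i \<noteq> j \<Longrightarrow> B (f i) (f j)"
    by (rule clique_in_large_sets[of "{..<k} - {p}" "\<lambda>i. nbrs x (Y \<inter> U i)"])
      (use assms in \<open>auto simp: nbrs_def\<close>)
  have "transversal_clique (insert x (f ` ({..<k} - {p})))"
    using assms f by (intro transversal_clique_through) (auto simp: nbrs_def)
  then show thesis using f by (intro that) (auto simp: nbrs_def)
qed

section \<open>Covering few vertices, and tiling greedily\<close>

lemma cover_by_cliques: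
  assumes "finite E" "E \<subseteq> verts"
    "\<And>e i j. e \<in> E \<Longrightarrow> e \<in> U i \<Longrightarrow> i < k \<Longrightarrow> j < k \<Longrightarrow> i \<noteq> j \<Longrightarrow>
       card (nbrs e (Y \<inter> U j)) \<ge> cliq + card E"
  shows "\<exists>S t. factorable S \<and> E \<subseteq> S \<and> S \<subseteq> E \<union> Y \<and> t \<le> card E \<and> balanced t S"
  using assms
proof (induction E rule: finite_induct)
  case empty
  then show ?case using factorable_empty by (intro exI[of _ "{}"]) (auto simp: balanced_def)
next
  case (insert e E)
  have "\<exists>S t. factorable S \<and> E \<subseteq> S \<and> S \<subseteq> E \<union> Y \<and> t \<le> card E \<and> balanced t S"
  proof (rule insert.IH)
    fix e' i j assume "e' \<in> E" "e' \<in> U i" "i < k" "j < k" "i \<noteq> j"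
    then have "cliq + card (insert e E) \<le> card (nbrs e' (Y \<inter> U j))"
      by (intro insert.prems(2)) auto
    then show "cliq + card E \<le> card (nbrs e' (Y \<inter> U j))" using insert.hyps by simp
  qed (use insert.prems in auto)
  then obtain S t where S: "factorable S" "E \<subseteq> S" "S \<subseteq> E \<union> Y" "t \<le> card E" "balanced t S" by blast
  show ?case
  \<comment> \<open>Y may meet the set to be covered, so an earlier clique may already contain
    e.\<close>
  proof (cases "e \<in> S")
    case True
    then show ?thesis using S insert.hyps by (intro exI[of _ S] exI[of _ t]) auto
  next
    case False
    obtain p where p: "p < k" "e \<in> U p" using insert.prems(1) unfolding verts_def by auto
    have "card (nbrs e ((Y - S) \<inter> U j)) \<ge> cliq" if j: "j < k" "j \<noteq> p" for j
    proof -
      have fin: "finite (S \<inter> U j)" using finite_U[OF j(1)] by auto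
      have "nbrs e ((Y - S) \<inter> U j) \<supseteq> nbrs e (Y \<inter> U j) - S \<inter> U j" unfolding nbrs_def by auto
      then have "card (nbrs e (Y \<inter> U j) - S \<inter> U j) \<le> card (nbrs e ((Y - S) \<inter> U j))"
        using finite_U[OF j(1)] by (intro card_mono) (auto simp: nbrs_def)
      moreover have "card (nbrs e (Y \<inter> U j)) - card (S \<inter> U j) \<le> card (nbrs e (Y \<inter> U j) - S \<inter> U j)"
        using fin by (rule diff_card_le_card_Diff)
      moreover have "card (S \<inter> U j) \<le> card E" using S j unfolding balanced_def by auto
      moreover have "cliq + card (insert e E) \<le> card (nbrs e (Y \<inter> U j))"
        using j p by (intro insert.prems(2)[of e p]) auto
      ultimately show ?thesis using insert.hyps by simp
    qed
    then obtain K where K: "transversal_clique K" "e \<in> K" "K \<subseteq> insert e (Y - S)"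
      using p clique_through_vertex[of p e "Y - S"] by metis
    have d: "S \<inter> K = {}" using K False by auto
    have "factorable (S \<union> K)" "balanced (t + 1) (S \<union> K)"
      using factorable_Un[OF S(1) factorable_clique[OF K(1)] d]
        balanced_Un[OF S(5) transversal_clique_balanced[OF K(1)] d] .
    then show ?thesis using S K insert.hyps
      by (intro exI[of _ "S \<union> K"] exI[of _ "t + 1"]) auto
  qed
qed

lemma greedy_cliques:
  assumes "balanced t Y"
  shows "\<exists>S u. factorable S \<and> S \<subseteq> Y \<and> balanced u (Y - S) \<and> u < cliq"
  using assms
proof (induction t arbitrary: Y)
  case 0
  moreover have "cliq > 0" unfolding clique_threshold_def using k_pos s_pos by simp
  ultimately show ?case using factorable_empty by (intro exI[of _ "{}"] exI[of _ 0]) auto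
next
  case (Suc t)
  show ?case
  proof (cases "Suc t < cliq")
    case True
    then show ?thesis using factorable_empty Suc.prems by (intro exI[of _ "{}"] exI[of _ "Suc t"]) auto
  next
    case False
    obtain f where f: "\<And>i. i \<in> {..<k} \<Longrightarrow> f i \<in> Y \<inter> U i"
      "\<And>i j. i \<in> {..<k} \<Longrightarrow> j \<in> {..<k} \<Longrightarrow> i \<noteq> j \<Longrightarrow> B (f i) (f j)"
      by (rule clique_in_large_sets[of "{..<k}" "\<lambda>i. Y \<inter> U i"])
        (use Suc.prems False in \<open>auto simp: balanced_def\<close>)
    define K where "K = f ` {..<k}"
    have K: "transversal_clique K" "K \<subseteq> Y"
      unfolding transversal_clique_def K_def using f by auto
    have "balanced t (Y - K)"
      using balanced_Diff[OF Suc.prems transversal_clique_balanced[OF K(1)] K(2)] by simp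
    then obtain S u where S: "factorable S" "S \<subseteq> Y - K" "balanced u (Y - K - S)" "u < cliq"
      using Suc.IH by blast
    moreover have "Y - K - S = Y - (K \<union> S)" by auto
    moreover have "factorable (K \<union> S)"
      using S factorable_clique[OF K(1)] by (intro factorable_Un) auto
    ultimately show ?thesis using K by (intro exI[of _ "K \<union> S"] exI[of _ u]) auto
  qed
qed

section \<open>Absorbers\<close>

lemma card_Diff_classes_ge:
  assumes "i < k" "X \<subseteq> U i" "a + card (S \<inter> U i) \<le> card X"
  shows "a \<le> card (X - S)"
proof -
  have "card X - card (S \<inter> U i) \<le> card (X - S \<inter> U i)"
    using finite_U[OF assms(1)] by (intro diff_card_le_card_Diff) auto
  moreover have "X - S \<inter> U i = X - S" using assms(2) by auto
  ultimately show ?thesis using assms(3) by simp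
qed

text \<open>For a transversal r, take a clique w and cliques S i inside the common neighbourhood of
  r i and w i in the other classes. Then S i and w i together tile the absorber, whereas S i and r i
  together with the clique w tile the absorber enlarged by r.\<close>

lemma absorber_exists:
  assumes deg: "\<And>i j x. i < k \<Longrightarrow> j < k \<Longrightarrow> i \<noteq> j \<Longrightarrow> x \<in> U i \<Longrightarrow>
      card (nbrs x (U j)) \<ge> (T + k + cliq) * s"
    and large: "\<And>i. i < k \<Longrightarrow> card (U i) \<ge> T + k * ((T + k + cliq) * s) + cliq"
    and used: "\<And>i. i < k \<Longrightarrow> card (Used \<inter> U i) \<le> T"
    and r: "\<And>i. i < k \<Longrightarrow> r i \<in> U i" "\<And>i. i < k \<Longrightarrow> r i \<in> Used"
  shows "\<exists>A. factorable A \<and> factorable (A \<union> r ` {..<k}) \<and> A \<inter> Used = {} \<and>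
    (\<forall>i<k. card (A \<inter> U i) \<le> k + 1)"
proof -
  \<comment> \<open>Of q common neighbours in a class, at most T lie in \<open>Used\<close>, one in
    w and fewer than k in the part of the absorber built so far; \<open>cliq\<close> of them
    remain.\<close>
  define q where "q = T + k + cliq"
  \<comment> \<open>By \<open>deg\<close>, r i has at least q * s neighbours in class j, so
    \<open>few_poor_vertices\<close> applies to this neighbourhood: most candidates for w i have q
    common neighbours with r i there.\<close>
  define Poor where "Poor i j = {x \<in> U i. card (nbrs x (nbrs (r i) (U j))) < q}" for i j
  define P where "P i = (\<Union>j\<in>{..<k}-{i}. Poor i j)" for i
  have cPoor: "card (Poor i j) \<le> q * s" if "i < k" "j < k" "i \<noteq> j" for i j
    unfolding Poor_def using that deg[of i j "r i"] r(1)[of i]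
    by (intro few_poor_vertices[of i j]) (auto simp: nbrs_def q_def)
  have cP: "card (P i) \<le> k * (q * s)" if i: "i < k" for i
  proof -
    have "card (P i) \<le> (\<Sum>j\<in>{..<k}-{i}. card (Poor i j))"
      unfolding P_def by (intro card_UN_le) auto
    also have "\<dots> \<le> (\<Sum>j\<in>{..<k}-{i}. q * s)" using cPoor i by (intro sum_mono) auto
    also have "\<dots> \<le> k * (q * s)" using card_mono[of "{..<k}" "{..<k} - {i}"] by auto
    finally show ?thesis .
  qed
  have cW: "cliq \<le> card (U i - P i - Used)" if i: "i < k" for i
  proof (rule card_Diff_classes_ge[OF i])
    have "cliq + card (Used \<inter> U i) \<le> card (U i - P i)"
    proof (rule card_Diff_classes_ge[OF i])
      have "card (P i \<inter> U i) \<le> card (P i)"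
        using finite_U[OF i] by (intro card_mono) (auto simp: P_def Poor_def)
      then show "cliq + card (Used \<inter> U i) + card (P i \<inter> U i) \<le> card (U i)"
        using cP[OF i] used[OF i] large[OF i] unfolding q_def by linarith
    qed auto
    then show "cliq + card (Used \<inter> U i) \<le> card (U i - P i)" .
  qed auto
  obtain w where w: "\<And>i. i \<in> {..<k} \<Longrightarrow> w i \<in> U i - P i - Used"
    "\<And>i j. i \<in> {..<k} \<Longrightarrow> j \<in> {..<k} \<Longrightarrow> i \<noteq> j \<Longrightarrow> B (w i) (w j)"
    by (rule clique_in_large_sets[of "{..<k}" "\<lambda>i. U i - P i - Used"]) (use cW in auto)
  let ?w = "w ` {..<k}"
  have wK: "transversal_clique ?w"
    unfolding transversal_clique_def using w by (intro exI[of _ w]) auto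
  have common: "card (nbrs (w i) (nbrs (r i) (U j))) \<ge> q" if "i < k" "j < k" "i \<noteq> j" for i j
  proof -
    have "w i \<notin> Poor i j" using w(1)[of i] that by (auto simp: P_def)
    then show ?thesis using w(1)[of i] that unfolding Poor_def by auto
  qed
  have disj_aux: "(S \<union> D) \<inter> insert x F = {}" if "S \<inter> (N \<union> W) = {}" "F \<inter> (N \<union> W \<union> S) = {}"
    "D \<subseteq> N \<union> W" "x \<in> N \<union> W" "x \<notin> D" for S N W F D :: "'v set" and x
    using that by blast
  \<comment> \<open>The induction treats w and r alike: the same S completes the first p vertices of
    either one. The clique on w is added only after the induction.\<close>
  have "\<exists>S. S \<inter> (Used \<union> ?w) = {} \<and> factorable (S \<union> w ` {..<p}) \<and> factorable (S \<union> r ` {..<p}) \<and>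
      (\<forall>i<k. card (S \<inter> U i) \<le> p)" if "p \<le> k" for p
    using that
  proof (induction p)
    case 0
    then show ?case using factorable_empty by (intro exI[of _ "{}"]) auto
  next
    case (Suc p)
    then obtain S where S: "S \<inter> (Used \<union> ?w) = {}" "factorable (S \<union> w ` {..<p})"
      "factorable (S \<union> r ` {..<p})" "\<And>i. i < k \<Longrightarrow> card (S \<inter> U i) \<le> p" by auto
    have p: "p < k" using Suc.prems by simp
    let ?I = "{..<k} - {p}"
    define X where "X j = nbrs (w p) (nbrs (r p) (U j)) - (Used \<union> ?w \<union> S)" for j
    have cX: "cliq \<le> card (X j)" if j: "j \<in> ?I" for j
      unfolding X_def
    proof (rule card_Diff_classes_ge[of j])
      have "card ((Used \<union> ?w \<union> S) \<inter> U j) \<le> card (Used \<inter> U j) + card (?w \<inter> U j) + card (S \<inter> U j)"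
        using card_Un_le[of "Used \<inter> U j \<union> ?w \<inter> U j" "S \<inter> U j"] card_Un_le[of "Used \<inter> U j" "?w \<inter> U j"]
        by (simp add: Int_Un_distrib2)
      moreover have "?w \<inter> U j = {w j}" using image_Int_class[of w j] w j by auto
      ultimately show "cliq + card ((Used \<union> ?w \<union> S) \<inter> U j) \<le> card (nbrs (w p) (nbrs (r p) (U j)))"
        using common[of p j] used[of j] S(4)[of j] p j unfolding q_def by simp
    qed (use j in \<open>auto simp: nbrs_def\<close>)
    obtain f where f: "\<And>i. i \<in> ?I \<Longrightarrow> f i \<in> X i"
      "\<And>i j. i \<in> ?I \<Longrightarrow> j \<in> ?I \<Longrightarrow> i \<noteq> j \<Longrightarrow> B (f i) (f j)"
      by (rule clique_in_large_sets[of ?I X]) (use cX in \<open>auto simp: X_def nbrs_def\<close>)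
    let ?f = "f ` ?I"
    have fw: "transversal_clique (insert (w p) ?f)"
      using f w p by (intro transversal_clique_through) (auto simp: X_def nbrs_def)
    have fr: "transversal_clique (insert (r p) ?f)"
      using f r p by (intro transversal_clique_through) (auto simp: X_def nbrs_def)
    have fdisj: "?f \<inter> (Used \<union> ?w \<union> S) = {}" using f(1) by (auto simp: X_def)
    have wp: "w p \<notin> w ` {..<p}" "r p \<notin> r ` {..<p}"
    proof -
      have "x p \<notin> x ` {..<p}" if "\<And>i. i < k \<Longrightarrow> x i \<in> U i" for x
      proof
        assume "x p \<in> x ` {..<p}"
        then obtain i where "i < p" "x p = x i" by auto
        then show False using that[of i] that[of p] class_unique[of "x p" p i] p by auto
      qed
      then show "w p \<notin> w ` {..<p}" "r p \<notin> r ` {..<p}" using w(1) r(1) by auto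
    qed
    have disj: "(S \<union> D) \<inter> insert x ?f = {}" if "D \<subseteq> Used \<union> ?w" "x \<in> Used \<union> ?w" "x \<notin> D" for D x
      by (rule disj_aux[OF S(1) fdisj that])
    have w_disj: "(S \<union> w ` {..<p}) \<inter> insert (w p) ?f = {}" using p by (intro disj wp) auto
    have r_disj: "(S \<union> r ` {..<p}) \<inter> insert (r p) ?f = {}" using p r(2) by (intro disj wp) auto
    have "factorable ((S \<union> w ` {..<p}) \<union> insert (w p) ?f)"
      by (rule factorable_Un[OF S(2) factorable_clique[OF fw] w_disj])
    moreover have "(S \<union> w ` {..<p}) \<union> insert (w p) ?f = (S \<union> ?f) \<union> w ` {..<Suc p}"
      by (auto simp: lessThan_Suc)
    ultimately have 1: "factorable ((S \<union> ?f) \<union> w ` {..<Suc p})" by simp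
    have "factorable ((S \<union> r ` {..<p}) \<union> insert (r p) ?f)"
      by (rule factorable_Un[OF S(3) factorable_clique[OF fr] r_disj])
    moreover have "(S \<union> r ` {..<p}) \<union> insert (r p) ?f = (S \<union> ?f) \<union> r ` {..<Suc p}"
      by (auto simp: lessThan_Suc)
    ultimately have 2: "factorable ((S \<union> ?f) \<union> r ` {..<Suc p})" by simp
    have 3: "card ((S \<union> ?f) \<inter> U i) \<le> Suc p" if i: "i < k" for i
    proof -
      have "card (?f \<inter> U i) \<le> card (insert (w p) ?f \<inter> U i)"
        using finite_U[OF i] by (intro card_mono) auto
      also have "\<dots> = 1" using transversal_clique_balanced[OF fw] i unfolding balanced_def by auto
      finally show ?thesis
        using card_Un_le[of "S \<inter> U i" "?f \<inter> U i"] S(4)[OF i] by (simp add: Int_Un_distrib2)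
    qed
    have "(S \<union> ?f) \<inter> (Used \<union> ?w) = {}" using S(1) fdisj by blast
    then show ?case using 1 2 3 by (intro exI[of _ "S \<union> ?f"] conjI allI impI)
  qed
  from this[of k] obtain S where S: "S \<inter> (Used \<union> ?w) = {}" "factorable (S \<union> ?w)"
      "factorable (S \<union> r ` {..<k})" "\<And>i. i < k \<Longrightarrow> card (S \<inter> U i) \<le> k" by auto
  have wUsed: "?w \<inter> Used = {}" using w(1) by auto
  have rUsed: "r ` {..<k} \<subseteq> Used" using r(2) by auto
  have "factorable ((S \<union> r ` {..<k}) \<union> ?w)"
    by (rule factorable_Un[OF S(3) factorable_clique[OF wK]])
      (use S(1) wUsed rUsed in \<open>simp add: Int_Un_distrib Int_Un_distrib2; blast\<close>)
  moreover have "(S \<union> r ` {..<k}) \<union> ?w = (S \<union> ?w) \<union> r ` {..<k}" by auto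
  moreover have "card ((S \<union> ?w) \<inter> U i) \<le> k + 1" if i: "i < k" for i
    using card_Un_le[of "S \<inter> U i" "?w \<inter> U i"] S(4)[OF i] transversal_clique_balanced[OF wK] i
    unfolding balanced_def by (simp add: Int_Un_distrib2)
  moreover have "(S \<union> ?w) \<inter> Used = {}" using S(1) wUsed by blast
  ultimately show ?thesis using S(2) by (intro exI[of _ "S \<union> ?w"]) simp
qed

definition transversals :: "'v set \<Rightarrow> 'v set set" where
  "transversals Z = (\<lambda>r. r ` {..<k}) ` (\<Pi>\<^sub>E i\<in>{..<k}. Z \<inter> U i)"

lemma card_transversals:
  assumes "balanced z Z" shows "finite (transversals Z)" "card (transversals Z) \<le> z ^ k"
proof -
  have fin: "finite (\<Pi>\<^sub>E i\<in>{..<k}. Z \<inter> U i)" using finite_U by (intro finite_PiE) auto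
  then show "finite (transversals Z)" unfolding transversals_def by auto
  have "card (transversals Z) \<le> card (\<Pi>\<^sub>E i\<in>{..<k}. Z \<inter> U i)"
    unfolding transversals_def using fin by (rule card_image_le)
  also have "\<dots> = z ^ k" using assms by (simp add: card_PiE balanced_def)
  finally show "card (transversals Z) \<le> z ^ k" .
qed

text \<open>Absorbers exist for transversals only. This turns any balanced remainder of Z into
  disjoint transversals, so that their absorbers can act independently.\<close>

lemma balanced_split_transversals:
  assumes "balanced t Z'" "Z' \<subseteq> Z"
  shows "\<exists>P \<subseteq> transversals Z. disjoint P \<and> \<Union>P = Z'"
  using assms
proof (induction t arbitrary: Z')
  case 0
  have "Z' = {}"
  proof (rule ccontr)
    assume "Z' \<noteq> {}"
    then obtain x where "x \<in> Z'" by blast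
    moreover from this obtain i where "i < k" "x \<in> U i" using 0 by (auto simp: balanced_def verts_def)
    moreover have "card (Z' \<inter> U i) = 0" "finite (Z' \<inter> U i)"
      using 0 \<open>i < k\<close> finite_U by (auto simp: balanced_def)
    ultimately show False by auto
  qed
  then show ?case by (intro exI[of _ "{}"]) auto
next
  case (Suc t)
  have "\<exists>x. x \<in> Z' \<inter> U i" if "i < k" for i
    using Suc.prems that by (metis balanced_def card.empty ex_in_conv nat.distinct(1))
  then obtain r0 where r0: "\<And>i. i < k \<Longrightarrow> r0 i \<in> Z' \<inter> U i" by metis
  define r where "r = restrict r0 {..<k}"
  have r: "r \<in> (\<Pi>\<^sub>E i\<in>{..<k}. Z' \<inter> U i)" using r0 unfolding r_def by auto
  let ?r = "r ` {..<k}"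
  have rZ: "?r \<subseteq> Z'" using r by auto
  have "balanced 1 ?r"
    unfolding balanced_def
  proof (intro conjI allI impI)
    show "?r \<subseteq> verts" using rZ Suc.prems by (auto simp: balanced_def)
    show "card (?r \<inter> U i) = 1" if "i < k" for i
    proof -
      have "?r \<inter> U i = {r i}" using r that by (intro image_Int_class) (auto simp: PiE_iff)
      then show ?thesis by simp
    qed
  qed
  then have "balanced t (Z' - ?r)" using balanced_Diff[OF Suc.prems(1) _ rZ] by fastforce
  then obtain P where P: "P \<subseteq> transversals Z" "disjoint P" "\<Union>P = Z' - ?r"
    using Suc.IH[of "Z' - ?r"] Suc.prems by blast
  have "?r \<in> transversals Z"
    unfolding transversals_def using r Suc.prems(2) by (intro imageI) (auto simp: PiE_iff)
  moreover have "disjoint (insert ?r P)"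
    using P by (auto simp: pairwise_insert disjnt_def)
  ultimately show ?case using P rZ by (intro exI[of _ "insert ?r P"]) auto
qed

text \<open>Since Z will be tiny compared to the classes, every transversal of Z can be given its own absorber.\<close>

lemma absorbing_set:
  assumes bal: "balanced z Z"
    and deg: "\<And>i j x. i < k \<Longrightarrow> j < k \<Longrightarrow> i \<noteq> j \<Longrightarrow> x \<in> U i \<Longrightarrow>
      card (nbrs x (U j)) \<ge> (z + (k + 1) * z ^ k + k + cliq) * s"
    and large: "\<And>i. i < k \<Longrightarrow> card (U i) \<ge>
      z + (k + 1) * z ^ k + k * ((z + (k + 1) * z ^ k + k + cliq) * s) + cliq"
  shows "\<exists>A. factorable A \<and> A \<inter> Z = {} \<and> (\<forall>i<k. card (A \<inter> U i) \<le> (k + 1) * z ^ k) \<and>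
    (\<forall>t Z'. balanced t Z' \<longrightarrow> Z' \<subseteq> Z \<longrightarrow> factorable (A \<union> Z'))"
proof -
  define T where "T = z + (k + 1) * z ^ k"
  \<comment> \<open>The absorbers are placed one after another, each avoiding Z and all earlier
    ones. As there are at most z ^ k of them, T bounds the occupied part of a class
    throughout.\<close>
  have "\<exists>A. A \<inter> Z = {} \<and> (\<forall>i<k. card (A \<inter> U i) \<le> (k + 1) * card Q) \<and>
      (\<forall>P \<subseteq> Q. disjoint P \<longrightarrow> factorable (A \<union> \<Union>P))"
    if "finite Q" "Q \<subseteq> transversals Z" for Q
    using that
  proof (induction Q rule: finite_induct)
    case empty
    then show ?case using factorable_empty by (intro exI[of _ "{}"]) auto
  next
    case (insert \<rho> Q)
    then obtain A where A: "A \<inter> Z = {}" "\<And>i. i < k \<Longrightarrow> card (A \<inter> U i) \<le> (k + 1) * card Q"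
      "\<And>P. P \<subseteq> Q \<Longrightarrow> disjoint P \<Longrightarrow> factorable (A \<union> \<Union>P)" by auto
    obtain r where r: "r \<in> (\<Pi>\<^sub>E i\<in>{..<k}. Z \<inter> U i)" "\<rho> = r ` {..<k}"
      using insert.prems unfolding transversals_def by auto
    have cQ: "card Q \<le> z ^ k"
      using insert.prems card_transversals[OF bal] card_mono[of "transversals Z" Q] by auto
    have used: "card ((Z \<union> A) \<inter> U i) \<le> T" if i: "i < k" for i
    proof -
      have "card ((Z \<union> A) \<inter> U i) \<le> card (Z \<inter> U i) + card (A \<inter> U i)"
        using card_Un_le[of "Z \<inter> U i" "A \<inter> U i"] by (simp add: Int_Un_distrib2)
      also have "\<dots> \<le> z + (k + 1) * card Q" using bal i A(2)[OF i] by (simp add: balanced_def)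
      also have "\<dots> \<le> T" unfolding T_def using cQ by (intro add_left_mono mult_left_mono) auto
      finally show ?thesis .
    qed
    obtain A' where A': "factorable A'" "factorable (A' \<union> \<rho>)" "A' \<inter> (Z \<union> A) = {}"
      "\<And>i. i < k \<Longrightarrow> card (A' \<inter> U i) \<le> k + 1"
    proof -
      have "\<exists>A'. factorable A' \<and> factorable (A' \<union> r ` {..<k}) \<and> A' \<inter> (Z \<union> A) = {} \<and>
        (\<forall>i<k. card (A' \<inter> U i) \<le> k + 1)"
        using deg large used r(1) unfolding T_def[symmetric]
        by (intro absorber_exists[of T "Z \<union> A" r]) auto
      then show thesis using that r(2) by blast
    qed
    have \<rho>Z: "\<rho> \<subseteq> Z" using r by auto
    have QZ: "\<Union>P \<subseteq> Z" if "P \<subseteq> insert \<rho> Q" for P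
    proof -
      have "\<tau> \<subseteq> Z" if "\<tau> \<in> transversals Z" for \<tau>
        using that unfolding transversals_def by (auto simp: PiE_iff)
      then show ?thesis using that insert.prems by blast
    qed
    show ?case
    proof (intro exI[of _ "A \<union> A'"] conjI allI impI)
      show "(A \<union> A') \<inter> Z = {}" using A A' by auto
      show "card ((A \<union> A') \<inter> U i) \<le> (k + 1) * card (insert \<rho> Q)" if i: "i < k" for i
        using card_Un_le[of "A \<inter> U i" "A' \<inter> U i"] A(2)[OF i] A'(4)[OF i] insert.hyps
        by (simp add: Int_Un_distrib2)
      fix P assume P: "P \<subseteq> insert \<rho> Q" "disjoint P"
      show "factorable (A \<union> A' \<union> \<Union>P)"
      \<comment> \<open>The new absorber A' is tiled on its own if its transversal is not to be
        absorbed, and together with it otherwise.\<close>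
      proof (cases "\<rho> \<in> P")
        case False
        then have "factorable (A \<union> \<Union>P)" using P by (intro A) auto
        moreover have "(A \<union> \<Union>P) \<inter> A' = {}" using A'(3) QZ[OF P(1)] by blast
        ultimately have "factorable ((A \<union> \<Union>P) \<union> A')" using factorable_Un A'(1) by blast
        then show ?thesis by (simp add: Un_ac)
      next
        case True
        define P' where "P' = P - {\<rho>}"
        have P': "P' \<subseteq> Q" "disjoint P'" "P = insert \<rho> P'"
          using P True unfolding P'_def by (auto simp: pairwise_def)
        have "\<rho> \<inter> \<Union>P' = {}"
          using P(2) unfolding P'(3) by (auto simp: pairwise_insert disjnt_def P'_def)
        moreover have "\<Union>P' \<subseteq> Z" using QZ[of P'] P' by auto
        ultimately have "(A \<union> \<Union>P') \<inter> (A' \<union> \<rho>) = {}" using A'(3) A(1) \<rho>Z by blast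
        then have "factorable ((A \<union> \<Union>P') \<union> (A' \<union> \<rho>))"
          using factorable_Un[OF A(3)[OF P'(1,2)] A'(2)] by blast
        then show ?thesis using P' by (simp add: Un_ac)
      qed
    qed
  qed
  from this[OF card_transversals(1)[OF bal]] obtain A where A: "A \<inter> Z = {}"
    "\<And>i. i < k \<Longrightarrow> card (A \<inter> U i) \<le> (k + 1) * card (transversals Z)"
    "\<And>P. P \<subseteq> transversals Z \<Longrightarrow> disjoint P \<Longrightarrow> factorable (A \<union> \<Union>P)" by auto
  have "factorable (A \<union> Z')" if "balanced t Z'" "Z' \<subseteq> Z" for t Z'
    using balanced_split_transversals[OF that] A(3) by metis
  moreover have "factorable A" using A(3)[of "{}"] by auto
  moreover have "card (A \<inter> U i) \<le> (k + 1) * z ^ k" if "i < k" for i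
    by (rule order_trans[OF A(2)[OF that]]) (use card_transversals(2)[OF bal] in \<open>auto simp del: mult_Suc\<close>)
  ultimately show ?thesis using A(1) by blast
qed

section \<open>Perfect tilings by absorption\<close>

theorem perfect_clique_factor:
  assumes deg: "\<And>i j x. i < k \<Longrightarrow> j < k \<Longrightarrow> i \<noteq> j \<Longrightarrow> x \<in> U i \<Longrightarrow> card (nbrs x (U j)) \<ge> factor_threshold k s"
    and size: "\<And>i. i < k \<Longrightarrow> card (U i) = M" and M: "M \<ge> factor_threshold k s"
  shows "factorable verts"
proof -
  \<comment> \<open>A vertex left over by the greedy tiling needs \<open>cliq\<close> neighbours in
    each other class of Z, plus one for each leftover vertex, of which there are at most k *
    cliq.\<close>
  define q where "q = cliq + k * cliq"
  define z where "z = q * s"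
  define T where "T = z + (k + 1) * z ^ k"
  have db: "factor_threshold k s = T + k * ((T + k + cliq) * s) + cliq + k * k * z"
    unfolding factor_threshold_def Let_def T_def z_def q_def by (simp add: algebra_simps)
  have k1: "(T + k + cliq) * s \<le> k * ((T + k + cliq) * s)" using k_pos by simp
  have zM: "z \<le> M" using M db T_def by linarith
  have "\<exists>Y \<subseteq> U i. card Y = z" if "i < k" for i
    using size[OF that] zM by (metis obtain_subset_with_card_n)
  then obtain Y where Y: "\<And>i. i < k \<Longrightarrow> Y i \<subseteq> U i" "\<And>i. i < k \<Longrightarrow> card (Y i) = z" by metis
  define Z where "Z = (\<Union>i<k. Y i)"
  have ZU: "Z \<inter> U i = Y i" if "i < k" for i
    using Y(1) that class_unique unfolding Z_def by blast
  have balZ: "balanced z Z"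
    unfolding balanced_def using ZU Y by (auto simp: Z_def verts_def)
  have "verts \<inter> U i = U i" if "i < k" for i using U_subset_verts[OF that] by blast
  then have balV: "balanced M verts" unfolding balanced_def using size by simp
  obtain A where A: "factorable A" "A \<inter> Z = {}" "\<And>i. i < k \<Longrightarrow> card (A \<inter> U i) \<le> (k + 1) * z ^ k"
    "\<And>t Z'. balanced t Z' \<Longrightarrow> Z' \<subseteq> Z \<Longrightarrow> factorable (A \<union> Z')"
  proof -
    have "\<exists>A. factorable A \<and> A \<inter> Z = {} \<and> (\<forall>i<k. card (A \<inter> U i) \<le> (k + 1) * z ^ k) \<and>
      (\<forall>t Z'. balanced t Z' \<longrightarrow> Z' \<subseteq> Z \<longrightarrow> factorable (A \<union> Z'))"
    proof (rule absorbing_set[OF balZ], unfold T_def[symmetric])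
      show "(T + k + cliq) * s \<le> card (nbrs x (U j))" if "i < k" "j < k" "i \<noteq> j" "x \<in> U i" for i j x
        using deg[OF that] db k1 by linarith
      show "T + k * ((T + k + cliq) * s) + cliq \<le> card (U i)" if "i < k" for i
        using size[OF that] M db by linarith
    qed
    then show thesis using that by blast
  qed
  \<comment> \<open>The reserve has q * s vertices in each class, exactly what
    \<open>few_poor_vertices\<close> requires; so each of the at most k * k sets X i j has at most z
    elements.\<close>
  define X where "X i j = {x \<in> U i. card (nbrs x (Y j)) < q}" for i j
  define E where "E = (\<Union>(i, j)\<in>{(i, j). i < k \<and> j < k \<and> i \<noteq> j}. X i j) - Z - A"
  have finE: "finite E" "E \<subseteq> verts"
  proof -
    show "E \<subseteq> verts" unfolding E_def X_def verts_def by auto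
    then show "finite E" using finite_verts finite_subset by blast
  qed
  have cE: "card E \<le> k * k * z"
  proof -
    let ?I = "{(i, j). i < k \<and> j < k \<and> i \<noteq> j}"
    have I: "?I \<subseteq> {..<k} \<times> {..<k}" by auto
    then have finI: "finite ?I" by (rule finite_subset) auto
    have "card ?I \<le> card ({..<k} \<times> {..<k})" using I by (intro card_mono) auto
    then have cI: "card ?I \<le> k * k" by simp
    have "card E \<le> card (\<Union>(i, j)\<in>?I. X i j)"
      unfolding E_def using finI finite_U by (intro card_mono) (auto simp: X_def)
    also have "\<dots> \<le> (\<Sum>(i, j)\<in>?I. card (X i j))"
      using card_UN_le[OF finI, of "\<lambda>(i, j). X i j"] by (simp add: case_prod_unfold)
    also have "\<dots> \<le> (\<Sum>(i, j)\<in>?I. z)"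
      using Y few_poor_vertices unfolding X_def z_def by (intro sum_mono) auto
    also have "\<dots> = card ?I * z" by simp
    also have "\<dots> \<le> k * k * z" using cI by simp
    finally show ?thesis .
  qed
  have "\<exists>S t. factorable S \<and> E \<subseteq> S \<and> S \<subseteq> E \<union> (verts - Z - A) \<and> t \<le> card E \<and> balanced t S"
  proof (rule cover_by_cliques[OF finE])
    fix e i j assume e: "e \<in> E" "e \<in> U i" "i < k" "j < k" "i \<noteq> j"
    have "cliq + card E \<le> card (nbrs e (U j) - (Z \<union> A))"
    proof (rule card_Diff_classes_ge[OF \<open>j < k\<close>])
      have "card ((Z \<union> A) \<inter> U j) \<le> T"
        using card_Un_le[of "Z \<inter> U j" "A \<inter> U j"] A(3)[of j] balZ e
        unfolding T_def balanced_def by (simp add: Int_Un_distrib2)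
      then show "cliq + card E + card ((Z \<union> A) \<inter> U j) \<le> card (nbrs e (U j))"
        using deg[of i j e] e db cE by linarith
    qed (auto simp: nbrs_def)
    moreover have "nbrs e (U j) - (Z \<union> A) = nbrs e ((verts - Z - A) \<inter> U j)"
      using U_subset_verts[of j] e by (auto simp: nbrs_def)
    ultimately show "cliq + card E \<le> card (nbrs e ((verts - Z - A) \<inter> U j))" by simp
  qed
  then obtain S1 t1 where S1': "factorable S1" "E \<subseteq> S1" "S1 \<subseteq> E \<union> (verts - Z - A)" "balanced t1 S1"
    by blast
  have "E \<inter> (Z \<union> A) = {}" unfolding E_def by blast
  then have "S1 \<inter> (Z \<union> A) = {}" using S1'(3) by blast
  note S1 = S1'(1,2) this S1'(4)
  obtain tA where tA: "balanced tA A" using A(1) factorable_balanced by blast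
  define R0 where "R0 = verts - (Z \<union> A \<union> S1)"
  have "balanced (z + tA + t1) (Z \<union> A \<union> S1)"
    using balanced_Un[OF balanced_Un[OF balZ tA] S1(4)] A(2) S1(3) by blast
  then have "balanced (M - (z + tA + t1)) R0"
    unfolding R0_def by (intro balanced_Diff[OF balV]) (auto simp: balanced_def)
  then obtain S2 u where S2: "factorable S2" "S2 \<subseteq> R0" "balanced u (R0 - S2)" "u < cliq"
    using greedy_cliques by blast
  define R where "R = R0 - S2"
  have finR: "finite R" "R \<subseteq> verts"
    using finite_verts unfolding R_def R0_def by auto
  have cR: "card R \<le> k * cliq"
  proof -
    have "R = (\<Union>i<k. R \<inter> U i)" using finR by (auto simp: verts_def)
    then have "card R \<le> (\<Sum>i<k. card (R \<inter> U i))" using card_UN_le[of "{..<k}" "\<lambda>i. R \<inter> U i"] by simp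
    also have "\<dots> = k * u" using S2(3) by (simp add: balanced_def R_def)
    finally show ?thesis using S2(4) by (meson less_imp_le mult_le_mono2 order_trans)
  qed
  have "\<exists>S t. factorable S \<and> R \<subseteq> S \<and> S \<subseteq> R \<union> Z \<and> t \<le> card R \<and> balanced t S"
  proof (rule cover_by_cliques[OF finR])
    fix e i j assume e: "e \<in> R" "e \<in> U i" "i < k" "j < k" "i \<noteq> j"
    have "e \<notin> E" "e \<notin> Z" "e \<notin> A" using e(1) S1(2) unfolding R_def R0_def by auto
    then have "e \<notin> X i j" using e unfolding E_def by auto
    then have "q \<le> card (nbrs e (Z \<inter> U j))" using e ZU unfolding X_def by auto
    then show "cliq + card R \<le> card (nbrs e (Z \<inter> U j))" using cR unfolding q_def by linarith
  qed
  then obtain S3 t3 where S3: "factorable S3" "R \<subseteq> S3" "S3 \<subseteq> R \<union> Z" "balanced t3 S3" by blast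
  obtain t2 where t2: "balanced t2 S2" using S2(1) factorable_balanced by blast
  have d12: "S1 \<inter> S2 = {}" and d123: "(S1 \<union> S2) \<inter> S3 = {}"
    and dA: "A \<inter> (S1 \<union> S2 \<union> S3) = {}"
    using S1(3) S2(2) S3(3) A(2) unfolding R_def R0_def by blast+
  have f123: "factorable (S1 \<union> S2 \<union> S3)"
    using factorable_Un[OF factorable_Un[OF S1(1) S2(1) d12] S3(1) d123] .
  have "balanced (tA + (t1 + t2 + t3)) (A \<union> (S1 \<union> S2 \<union> S3))"
    by (rule balanced_Un[OF tA balanced_Un[OF balanced_Un[OF S1(4) t2 d12] S3(4) d123] dA])
  then have "balanced (M - (tA + (t1 + t2 + t3))) (verts - (A \<union> (S1 \<union> S2 \<union> S3)))"
    by (intro balanced_Diff[OF balV]) (auto simp: balanced_def)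
  moreover have "verts - (A \<union> (S1 \<union> S2 \<union> S3)) \<subseteq> Z"
    using S3(2) unfolding R_def R0_def by auto
  ultimately have "factorable (A \<union> (verts - (A \<union> (S1 \<union> S2 \<union> S3))))" by (rule A(4))
  then have "factorable ((A \<union> (verts - (A \<union> (S1 \<union> S2 \<union> S3)))) \<union> (S1 \<union> S2 \<union> S3))"
    by (rule factorable_Un[OF _ f123]) (use dA in blast)
  moreover have "(A \<union> (verts - (A \<union> (S1 \<union> S2 \<union> S3)))) \<union> (S1 \<union> S2 \<union> S3) = verts"
    using factorable_subset A(1) f123 by blast
  ultimately show ?thesis by simp
qed

end

section \<open>Random multipartite tournaments\<close>

definition oriented_pairs :: "nat \<Rightarrow> (nat \<Rightarrow> nat) \<Rightarrow> ((nat \<times> nat) \<times> (nat \<times> nat)) set \<Rightarrow> bool" where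
  "oriented_pairs k n Q \<longleftrightarrow>
     (\<forall>(u, v)\<in>Q. u \<in> kp_vertices k n \<and> v \<in> kp_vertices k n \<and> fst u \<noteq> fst v \<and> (v, u) \<notin> Q)"

lemma finite_kp_vertices: "finite (kp_vertices k n)"
proof -
  have "kp_vertices k n = Sigma {..<k} (\<lambda>i. {..<n i})" unfolding kp_vertices_def by auto
  then show ?thesis by simp
qed

lemma finite_kp_tournaments: "finite (kp_tournaments k n)"
proof (rule finite_subset)
  show "kp_tournaments k n \<subseteq> Pow (kp_vertices k n \<times> kp_vertices k n)"
    unfolding kp_tournaments_def by auto
qed (use finite_kp_vertices in auto)

lemma kp_tournaments_nonempty: "kp_tournaments k n \<noteq> {}"
proof -
  have "{(u, v). u \<in> kp_vertices k n \<and> v \<in> kp_vertices k n \<and> fst u < fst v} \<in> kp_tournaments k n"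
    unfolding kp_tournaments_def by auto
  then show ?thesis by blast
qed

lemma kp_tournamentD:
  assumes "A \<in> kp_tournaments k n" "(u, v) \<in> A"
  shows "u \<in> kp_vertices k n" "v \<in> kp_vertices k n" "fst u \<noteq> fst v" "(v, u) \<notin> A"
proof -
  have "A \<subseteq> {(u, v). u \<in> kp_vertices k n \<and> v \<in> kp_vertices k n \<and> fst u \<noteq> fst v}"
    using assms(1) unfolding kp_tournaments_def by blast
  then show *: "u \<in> kp_vertices k n" "v \<in> kp_vertices k n" "fst u \<noteq> fst v" using assms(2) by auto
  show "(v, u) \<notin> A" using assms * unfolding kp_tournaments_def by blast
qed

lemma kp_tournament_total:
  assumes "A \<in> kp_tournaments k n" "u \<in> kp_vertices k n" "v \<in> kp_vertices k n" "fst u \<noteq> fst v"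
  shows "(u, v) \<in> A \<or> (v, u) \<in> A"
  using assms unfolding kp_tournaments_def by blast

lemma flip_in_kp_tournaments:
  assumes "A \<in> kp_tournaments k n" "(u, v) \<in> A"
  shows "insert (v, u) (A - {(u, v)}) \<in> kp_tournaments k n"
proof -
  note uv = kp_tournamentD[OF assms]
  show ?thesis
    unfolding kp_tournaments_def
  proof (intro CollectI conjI ballI impI)
    have "A \<subseteq> {(u, v). u \<in> kp_vertices k n \<and> v \<in> kp_vertices k n \<and> fst u \<noteq> fst v}"
      using assms(1) unfolding kp_tournaments_def by blast
    then show "insert (v, u) (A - {(u, v)}) \<subseteq>
        {(u, v). u \<in> kp_vertices k n \<and> v \<in> kp_vertices k n \<and> fst u \<noteq> fst v}"
      using uv by auto
    fix x y assume "x \<in> kp_vertices k n" "y \<in> kp_vertices k n" "fst x \<noteq> fst y"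
    then have "(x, y) \<in> A \<longleftrightarrow> (y, x) \<notin> A"
      using assms(1) unfolding kp_tournaments_def by blast
    then show "(x, y) \<in> insert (v, u) (A - {(u, v)}) \<longleftrightarrow> (y, x) \<notin> insert (v, u) (A - {(u, v)})"
      using uv by auto
  qed
qed

text \<open>Counting takes the place of independence. Reversing the edge e maps the tournaments that
  contain \<open>insert e Q\<close> injectively to tournaments that contain Q but not e, so each
  prescribed edge at least halves their number.\<close>

lemma card_kp_tournaments_supset:
  assumes "finite Q" "oriented_pairs k n Q"
  shows "card {A \<in> kp_tournaments k n. Q \<subseteq> A} * 2 ^ card Q \<le> card (kp_tournaments k n)"
  using assms
proof (induction Q rule: finite_induct)
  case empty
  then show ?case by simp
next
  case (insert e Q)
  obtain u v where e: "e = (u, v)" by (cases e)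
  let ?L = "{A \<in> kp_tournaments k n. insert e Q \<subseteq> A}"
  let ?R = "{A \<in> kp_tournaments k n. Q \<subseteq> A}"
  let ?flip = "\<lambda>A. insert (v, u) (A - {(u, v)})"
  have ori: "oriented_pairs k n Q" and vu: "(v, u) \<notin> Q" "u \<noteq> v"
    using insert.prems e unfolding oriented_pairs_def by auto
  have inj: "inj_on ?flip ?L"
  proof (rule inj_onI)
    fix A A' assume A: "A \<in> ?L" "A' \<in> ?L" and eq: "?flip A = ?flip A'"
    have "(v, u) \<notin> A" "(v, u) \<notin> A'" using A kp_tournamentD(4)[of A k n u v] kp_tournamentD(4)[of A' k n u v] e by auto
    then have "insert (u, v) (?flip A - {(v, u)}) = A" "insert (u, v) (?flip A' - {(v, u)}) = A'"
      using A e vu by auto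
    then show "A = A'" using arg_cong[OF eq, of "\<lambda>X. insert (u, v) (X - {(v, u)})"] by simp
  qed
  have sub: "?flip ` ?L \<subseteq> ?R"
  proof
    fix A' assume "A' \<in> ?flip ` ?L"
    then obtain A where A: "A \<in> ?L" "A' = ?flip A" by blast
    have "A' \<in> kp_tournaments k n" unfolding A(2) using A(1) e by (intro flip_in_kp_tournaments) auto
    moreover have "Q \<subseteq> A'" using A insert.hyps e by auto
    ultimately show "A' \<in> ?R" by simp
  qed
  have "2 * card ?L = card ?L + card (?flip ` ?L)" using card_image[OF inj] by simp
  also have "\<dots> = card (?L \<union> ?flip ` ?L)"
    using finite_kp_tournaments[of k n] e vu by (intro card_Un_disjoint[symmetric]) auto
  also have "\<dots> \<le> card ?R"
  proof (rule card_mono)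
    show "finite ?R" using finite_kp_tournaments[of k n] by simp
    show "?L \<union> ?flip ` ?L \<subseteq> ?R" using sub by blast
  qed
  finally have "2 * card ?L * 2 ^ card Q \<le> card ?R * 2 ^ card Q" by simp
  also have "\<dots> \<le> card (kp_tournaments k n)" by (rule insert.IH[OF ori])
  finally show ?case using insert.hyps by (simp add: ac_simps)
qed

text \<open>Each w in W excludes one of the four orientations of its two edges to u and v; Q records
  the orientations already fixed.\<close>

lemma card_kp_tournaments_no_path:
  assumes "finite W" "W \<subseteq> kp_vertices k n" "u \<in> kp_vertices k n" "v \<in> kp_vertices k n" "u \<noteq> v"
    and "\<And>w. w \<in> W \<Longrightarrow> fst w \<noteq> fst u \<and> fst w \<noteq> fst v"
    and "finite Q" "oriented_pairs k n Q" "\<And>x y. (x, y) \<in> Q \<Longrightarrow> x \<notin> W \<and> y \<notin> W"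
  shows "card {A \<in> kp_tournaments k n. Q \<subseteq> A \<and> (\<forall>w\<in>W. \<not> ((v, w) \<in> A \<and> (w, u) \<in> A))} *
    (4 ^ card W * 2 ^ card Q) \<le> 3 ^ card W * card (kp_tournaments k n)"
  using assms(1,2,6-)
proof (induction W arbitrary: Q rule: finite_induct)
  case empty
  then show ?case using card_kp_tournaments_supset[of Q k n] by simp
next
  case (insert w W)
  let ?T = "\<lambda>Q W. {A \<in> kp_tournaments k n. Q \<subseteq> A \<and> (\<forall>w\<in>W. \<not> ((v, w) \<in> A \<and> (w, u) \<in> A))}"
  let ?c = "card (kp_tournaments k n)"
  let ?f = "4 ^ card W * 2 ^ (card Q + 2) :: nat"
  have w: "w \<in> kp_vertices k n" "fst w \<noteq> fst u" "fst w \<noteq> fst v" using insert.prems by auto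
  then have wuv: "w \<noteq> u" "w \<noteq> v" by auto
  have wQ: "(v, w) \<notin> Q" "(w, v) \<notin> Q" "(u, w) \<notin> Q" "(w, u) \<notin> Q"
    using insert.prems(5) by blast+
  \<comment> \<open>u and v lie in classes disjoint from W, so fixing the edges from w to them still
    prescribes nothing at the vertices left in W.\<close>
  have uW: "u \<notin> W" "v \<notin> W" using insert.prems(2)[of u] insert.prems(2)[of v] by auto
  have bound: "card (?T (Q \<union> {a, b}) W) * ?f \<le> 3 ^ card W * ?c"
    if ab: "a \<in> {(v, w), (w, v)}" "b \<in> {(u, w), (w, u)}" for a b
  proof -
    have "card (Q \<union> {a, b}) = card Q + card {a, b}"
      using ab wQ insert.prems(3) by (intro card_Un_disjoint) auto
    moreover have "a \<noteq> b" using ab wuv assms(5) by auto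
    ultimately have c: "card (Q \<union> {a, b}) = card Q + 2" by simp
    have "oriented_pairs k n (Q \<union> {a, b})"
      using insert.prems(4) ab wQ w wuv assms(3-5) unfolding oriented_pairs_def by auto
    then have "card (?T (Q \<union> {a, b}) W) * (4 ^ card W * 2 ^ card (Q \<union> {a, b})) \<le> 3 ^ card W * ?c"
      using insert.prems insert.hyps(2) ab uW by (intro insert.IH) auto
    then show ?thesis unfolding c .
  qed
  \<comment> \<open>The three orientations that avoid the path from v over w to u. Each one adds two
    edges to Q, so each has weight 1/4 in the induction hypothesis, and together they give the
    factor 3/4.\<close>
  let ?S1 = "?T (Q \<union> {(v, w), (u, w)}) W" and ?S2 = "?T (Q \<union> {(w, v), (u, w)}) W"
    and ?S3 = "?T (Q \<union> {(w, v), (w, u)}) W"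
  have "?T Q (insert w W) \<subseteq> ?S1 \<union> (?S2 \<union> ?S3)"
  proof
    fix A assume A: "A \<in> ?T Q (insert w W)"
    have "(v, w) \<in> A \<or> (w, v) \<in> A" "(u, w) \<in> A \<or> (w, u) \<in> A"
      using A w assms(3,4) kp_tournament_total[of A k n v w] kp_tournament_total[of A k n u w] by auto
    then show "A \<in> ?S1 \<union> (?S2 \<union> ?S3)" using A by auto
  qed
  then have "card (?T Q (insert w W)) \<le> card (?S1 \<union> (?S2 \<union> ?S3))"
    using finite_kp_tournaments[of k n] by (intro card_mono) auto
  also have "\<dots> \<le> card ?S1 + (card ?S2 + card ?S3)"
    by (rule order_trans[OF card_Un_le add_left_mono[OF card_Un_le]])
  finally have "card (?T Q (insert w W)) * ?f \<le> (card ?S1 + (card ?S2 + card ?S3)) * ?f"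
    by (rule mult_le_mono1)
  also have "\<dots> = card ?S1 * ?f + (card ?S2 * ?f + card ?S3 * ?f)" by (simp only: add_mult_distrib)
  also have "\<dots> \<le> 3 ^ card W * ?c + (3 ^ card W * ?c + 3 ^ card W * ?c)"
    by (intro add_mono bound) auto
  finally show ?case using insert.hyps by (simp add: ac_simps)
qed

section \<open>Probabilities of the two failure events\<close>

lemma prob_random_kp_tournament:
  "measure_pmf.prob (random_kp_tournament k n) {A. P A} =
    real (card {A \<in> kp_tournaments k n. P A}) / real (card (kp_tournaments k n))"
  unfolding random_kp_tournament_def
  using measure_pmf_of_set[OF kp_tournaments_nonempty finite_kp_tournaments]
  by (simp add: Collect_conj_eq Int_commute)

lemma card_kp_tournaments_pos: "card (kp_tournaments k n) > 0"
  using finite_kp_tournaments kp_tournaments_nonempty by (simp add: card_gt_0_iff)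

lemma prob_supset_le:
  assumes "finite Q" "oriented_pairs k n Q"
  shows "measure_pmf.prob (random_kp_tournament k n) {A. Q \<subseteq> A} \<le> 1 / 2 ^ card Q"
proof -
  have "real (card {A \<in> kp_tournaments k n. Q \<subseteq> A} * 2 ^ card Q) \<le> real (card (kp_tournaments k n))"
    using card_kp_tournaments_supset[OF assms] by (simp only: of_nat_le_iff)
  then show ?thesis
    unfolding prob_random_kp_tournament using card_kp_tournaments_pos[of k n]
    by (simp add: field_simps)
qed

lemma prob_no_path_le:
  assumes "finite W" "W \<subseteq> kp_vertices k n" "u \<in> kp_vertices k n" "v \<in> kp_vertices k n" "u \<noteq> v"
    and "\<And>w. w \<in> W \<Longrightarrow> fst w \<noteq> fst u \<and> fst w \<noteq> fst v"
  shows "measure_pmf.prob (random_kp_tournament k n) {A. \<forall>w\<in>W. \<not> ((v, w) \<in> A \<and> (w, u) \<in> A)}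
    \<le> (3 / 4) ^ card W"
proof -
  let ?X = "{A \<in> kp_tournaments k n. \<forall>w\<in>W. \<not> ((v, w) \<in> A \<and> (w, u) \<in> A)}"
  have "card ?X * 4 ^ card W \<le> 3 ^ card W * card (kp_tournaments k n)"
    using card_kp_tournaments_no_path[of W k n u v "{}"] assms by (simp add: oriented_pairs_def)
  then have "real (card ?X * 4 ^ card W) \<le> real (3 ^ card W * card (kp_tournaments k n))"
    by (simp only: of_nat_le_iff)
  then show ?thesis
    unfolding prob_random_kp_tournament using card_kp_tournaments_pos[of k n]
    by (simp add: field_simps)
qed

definition unidirectional :: "nat \<Rightarrow> nat \<Rightarrow> nat \<Rightarrow> ((nat \<times> nat) \<times> (nat \<times> nat)) set \<Rightarrow> bool" where
  "unidirectional k m a A \<longleftrightarrow> (\<exists>i<k. \<exists>j<k. i \<noteq> j \<and> (\<exists>X Y. X \<subseteq> {i} \<times> {..<m} \<and> Y \<subseteq> {j} \<times> {..<m} \<and>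
     card X = a \<and> card Y = a \<and> X \<times> Y \<subseteq> A))"

text \<open>u and v may share a class; only the class j of the middle vertices has to differ from
  theirs.\<close>

definition few_paths :: "nat \<Rightarrow> nat \<Rightarrow> nat \<Rightarrow> ((nat \<times> nat) \<times> (nat \<times> nat)) set \<Rightarrow> bool" where
  "few_paths k m d A \<longleftrightarrow> (\<exists>j<k. \<exists>u\<in>{..<k} \<times> {..<m}. \<exists>v\<in>{..<k} \<times> {..<m}. u \<noteq> v \<and> fst u \<noteq> j \<and> fst v \<noteq> j \<and>
     card {w \<in> {j} \<times> {..<m}. (v, w) \<in> A \<and> (w, u) \<in> A} < d)"

lemma prob_Union_le:
  assumes "finite I" "{A. P A} \<subseteq> (\<Union>i\<in>I. {A. R i A})"
    "\<And>i. i \<in> I \<Longrightarrow> measure_pmf.prob p {A. R i A} \<le> b" "real (card I) \<le> c" "b \<ge> 0"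
  shows "measure_pmf.prob p {A. P A} \<le> c * b"
proof -
  have "measure_pmf.prob p {A. P A} \<le> measure_pmf.prob p (\<Union>i\<in>I. {A. R i A})"
    using assms(2) by (intro measure_pmf.finite_measure_mono) auto
  also have "\<dots> \<le> (\<Sum>i\<in>I. measure_pmf.prob p {A. R i A})"
    using assms(1) by (intro measure_pmf.finite_measure_subadditive_finite) auto
  also have "\<dots> \<le> (\<Sum>i\<in>I. b)" using assms(3) by (intro sum_mono)
  also have "\<dots> = real (card I) * b" by simp
  also have "\<dots> \<le> c * b" using assms(4,5) by (intro mult_right_mono)
  finally show ?thesis .
qed

lemma card_subsets_of_size_le:
  assumes "finite S" shows "card {X. X \<subseteq> S \<and> card X = a} \<le> card S ^ a"
proof (cases "a \<le> card S")
  case True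
  then show ?thesis using n_subsets[OF assms, of a] binomial_le_pow[of a "card S"] by simp
next
  case False
  then show ?thesis using n_subsets[OF assms, of a] by (simp add: binomial_eq_0)
qed

text \<open>A union bound over at most k^2 pairs of classes and m^a sets on each side; a fixed
  choice of X and Y prescribes a * a edges.\<close>

lemma prob_unidirectional_le:
  assumes "\<And>i. i < k \<Longrightarrow> m \<le> n i"
  shows "measure_pmf.prob (random_kp_tournament k n) {A. unidirectional k m a A}
    \<le> (real k ^ 2 * real m ^ (2 * a)) * (1 / 2 ^ (a * a))"
proof (rule prob_Union_le[where R = "\<lambda>(i, j, X, Y) A. X \<times> Y \<subseteq> A"])
  let ?S = "\<lambda>i. {X. X \<subseteq> {i} \<times> {..<m} \<and> card X = a}"
  let ?I = "SIGMA i:{..<k}. SIGMA j:{..<k}-{i}. ?S i \<times> ?S j"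
  have fS: "finite (?S i)" for i by (rule finite_subset[of _ "Pow ({i} \<times> {..<m})"]) auto
  then show "finite ?I" by auto
  show "{A. unidirectional k m a A} \<subseteq> (\<Union>x\<in>?I. {A. (case x of (i, j, X, Y) \<Rightarrow> \<lambda>A. X \<times> Y \<subseteq> A) A})"
  proof
    fix A assume "A \<in> {A. unidirectional k m a A}"
    then obtain i j X Y where "i < k" "j < k" "i \<noteq> j" "X \<in> ?S i" "Y \<in> ?S j" "X \<times> Y \<subseteq> A"
      unfolding unidirectional_def by blast
    then show "A \<in> (\<Union>x\<in>?I. {A. (case x of (i, j, X, Y) \<Rightarrow> \<lambda>A. X \<times> Y \<subseteq> A) A})"
      by (intro UN_I[of "(i, j, X, Y)"]) auto
  qed
  have cS: "card (?S i) \<le> m ^ a" for i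
    using card_subsets_of_size_le[of "{i} \<times> {..<m}" a] by simp
  have "card ?I = (\<Sum>i<k. \<Sum>j\<in>{..<k}-{i}. card (?S i) * card (?S j))"
    using fS by simp
  also have "\<dots> \<le> (\<Sum>i<k. \<Sum>j\<in>{..<k}-{i}. m ^ a * m ^ a)"
    using cS by (intro sum_mono mult_mono) auto
  also have "\<dots> \<le> (\<Sum>i<k. \<Sum>j<k. m ^ a * m ^ a)"
    by (intro sum_mono sum_mono2) auto
  also have "\<dots> = k ^ 2 * m ^ (2 * a)" by (simp add: power2_eq_square mult_2 power_add)
  finally have "real (card ?I) \<le> real (k ^ 2 * m ^ (2 * a))" by (simp only: of_nat_le_iff)
  then show "real (card ?I) \<le> real k ^ 2 * real m ^ (2 * a)" by simp
  fix x assume x: "x \<in> ?I"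
  then obtain i j X Y where *: "x = (i, j, X, Y)" "i < k" "j < k" "i \<noteq> j" "X \<in> ?S i" "Y \<in> ?S j" by auto
  have "finite X" "finite Y"
    using *(5,6) finite_subset[of X "{i} \<times> {..<m}"] finite_subset[of Y "{j} \<times> {..<m}"] by auto
  then have "finite (X \<times> Y)" by simp
  moreover have "oriented_pairs k n (X \<times> Y)"
  proof -
    have "{i} \<times> {..<m} \<subseteq> kp_vertices k n" "{j} \<times> {..<m} \<subseteq> kp_vertices k n"
      using *(2,3) assms[of i] assms[of j] unfolding kp_vertices_def by auto
    then have X: "X \<subseteq> kp_vertices k n" "Y \<subseteq> kp_vertices k n" using *(5,6) by auto
    have "fst u = i" if "u \<in> X" for u using that *(5) by auto
    moreover have "fst u = j" if "u \<in> Y" for u using that *(6) by auto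
    ultimately show ?thesis using X *(4) unfolding oriented_pairs_def by blast
  qed
  moreover have "card (X \<times> Y) = a * a" using *(5,6) by (simp add: card_cartesian_product)
  ultimately have "measure_pmf.prob (random_kp_tournament k n) {A. X \<times> Y \<subseteq> A} \<le> 1 / 2 ^ (a * a)"
    using prob_supset_le by metis
  then show "measure_pmf.prob (random_kp_tournament k n) {A. (case x of (i, j, X, Y) \<Rightarrow> \<lambda>A. X \<times> Y \<subseteq> A) A}
      \<le> 1 / 2 ^ (a * a)" using * by simp
qed simp

text \<open>Blocks replace a concentration inequality. Cut d * g vertices of class j into d blocks
  of size g. If every block contained a middle vertex, there would be d paths; so fewer than d paths
  leave a block without any, which has probability at most (3/4)^g. The union bound ranges over j,
  u, v and the block.\<close>

lemma prob_few_paths_le: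
  assumes "\<And>i. i < k \<Longrightarrow> m \<le> n i" "d * g \<le> m"
  shows "measure_pmf.prob (random_kp_tournament k n) {A. few_paths k m d A}
    \<le> (real k ^ 3 * real m ^ 2 * real d) * (3 / 4) ^ g"
proof -
  define W where "W j h = {j} \<times> {h * g..<h * g + g}" for j h :: nat
  define V where "V = {..<k} \<times> {..<m}"
  define I where "I = {(j, u, v, h). j < k \<and> u \<in> V \<and> v \<in> V \<and> h < d \<and> u \<noteq> v \<and> fst u \<noteq> j \<and> fst v \<noteq> j}"
  define R where "R = (\<lambda>(j, u, v, h) A. \<forall>w\<in>W j h. \<not> ((v, w) \<in> A \<and> (w, u) \<in> (A :: ((nat \<times> nat) \<times> (nat \<times> nat)) set)))"
  have Wm: "W j h \<subseteq> {j} \<times> {..<m}" if "h < d" for j h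
  proof -
    have "(h + 1) * g \<le> d * g" using that by (intro mult_right_mono) auto
    then have "h * g + g \<le> m" using assms(2) by simp
    then show ?thesis unfolding W_def by auto
  qed
  have Wdisj: "h = h'" if "w \<in> W j h" "w \<in> W j h'" for w j h h'
  proof -
    have "snd w div g = h" if "w \<in> W j h" for h
      using that unfolding W_def by (auto intro!: div_nat_eqI simp: mult.commute)
    then show ?thesis using that by metis
  qed
  have IV: "I \<subseteq> {..<k} \<times> V \<times> V \<times> {..<d}" unfolding I_def by auto
  have finV: "finite V" unfolding V_def by simp
  have finI: "finite I" by (rule finite_subset[OF IV]) (use finV in auto)
  show ?thesis
  proof (rule prob_Union_le[OF finI, where R = R])
    show "{A. few_paths k m d A} \<subseteq> (\<Union>x\<in>I. {A. R x A})"
    proof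
      fix A assume "A \<in> {A. few_paths k m d A}"
      then obtain j u v where juv: "j < k" "u \<in> V" "v \<in> V" "u \<noteq> v" "fst u \<noteq> j" "fst v \<noteq> j"
        and few: "card {w \<in> {j} \<times> {..<m}. (v, w) \<in> A \<and> (w, u) \<in> A} < d"
        unfolding few_paths_def V_def by blast
      have "\<exists>h<d. R (j, u, v, h) A"
      proof (rule ccontr)
        assume "\<not> ?thesis"
        then have "\<forall>h<d. \<exists>w\<in>W j h. (v, w) \<in> A \<and> (w, u) \<in> A" unfolding R_def by auto
        then obtain w where w: "\<And>h. h < d \<Longrightarrow> w h \<in> W j h \<and> (v, w h) \<in> A \<and> (w h, u) \<in> A" by metis
        have "inj_on w {..<d}" using w Wdisj by (intro inj_onI) (metis lessThan_iff)
        then have "d = card (w ` {..<d})" by (simp add: card_image)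
        also have "\<dots> \<le> card {w \<in> {j} \<times> {..<m}. (v, w) \<in> A \<and> (w, u) \<in> A}"
        proof (rule card_mono)
          show "w ` {..<d} \<subseteq> {w \<in> {j} \<times> {..<m}. (v, w) \<in> A \<and> (w, u) \<in> A}"
          proof
            fix x assume "x \<in> w ` {..<d}"
            then obtain h where "h < d" "x = w h" by auto
            then show "x \<in> {w \<in> {j} \<times> {..<m}. (v, w) \<in> A \<and> (w, u) \<in> A}"
              using w[of h] Wm[of h j] by blast
          qed
        qed auto
        finally show False using few by simp
      qed
      then show "A \<in> (\<Union>x\<in>I. {A. R x A})" using juv unfolding I_def by blast
    qed
    fix x assume "x \<in> I"
    then obtain j u v h where x: "x = (j, u, v, h)" "j < k" "u \<in> V" "v \<in> V" "h < d" "u \<noteq> v"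
      "fst u \<noteq> j" "fst v \<noteq> j" unfolding I_def by blast
    have V: "V \<subseteq> kp_vertices k n" using assms(1) unfolding V_def kp_vertices_def by fastforce
    have "{j} \<times> {..<m} \<subseteq> V" using x unfolding V_def by auto
    then have "W j h \<subseteq> kp_vertices k n" using Wm[of h j] x V by blast
    then have "measure_pmf.prob (random_kp_tournament k n)
        {A. \<forall>w\<in>W j h. \<not> ((v, w) \<in> A \<and> (w, u) \<in> A)} \<le> (3 / 4) ^ card (W j h)"
      using x V by (intro prob_no_path_le) (auto simp: W_def)
    moreover have "card (W j h) = g" unfolding W_def by simp
    ultimately show "measure_pmf.prob (random_kp_tournament k n) {A. R x A} \<le> (3 / 4) ^ g"
      unfolding R_def x by simp
  next
    have "card I \<le> card ({..<k} \<times> V \<times> V \<times> {..<d})" using IV finV by (intro card_mono) auto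
    also have "\<dots> = k ^ 3 * m ^ 2 * d" by (simp add: V_def power2_eq_square power3_eq_cube)
    finally have "real (card I) \<le> real (k ^ 3 * m ^ 2 * d)" by (simp only: of_nat_le_iff)
    then show "real (card I) \<le> real k ^ 3 * real m ^ 2 * real d" by simp
  qed simp
qed

section \<open>Feedback arc sets and linear orders\<close>

text \<open>A shortest closed walk in A - F has no repeated vertex, since a repetition would give a
  shorter one. It is thus a directed cycle of A that F fails to meet.\<close>

lemma feedback_acyclic:
  assumes "feedback_arc_set A F" "\<And>x. (x, x) \<notin> A"
  shows "acyclic (A - F)"
proof (rule ccontr)
  let ?R = "A - F"
  assume "\<not> acyclic ?R"
  then obtain x where "(x, x) \<in> ?R\<^sup>+" unfolding acyclic_def by blast
  then have "\<exists>n. n > 0 \<and> (\<exists>x. (x, x) \<in> ?R ^^ n)" by (auto simp: trancl_power)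
  then obtain n where n: "n > 0" "\<exists>x. (x, x) \<in> ?R ^^ n"
    and least: "\<And>l. l > 0 \<Longrightarrow> (\<exists>x. (x, x) \<in> ?R ^^ l) \<Longrightarrow> n \<le> l"
    using exists_least_iff[of "\<lambda>n. n > 0 \<and> (\<exists>x. (x, x) \<in> ?R ^^ n)"] by (metis not_less)
  then obtain f where f: "f 0 = f n" "\<And>i. i < n \<Longrightarrow> (f i, f (Suc i)) \<in> ?R"
    unfolding relpow_fun_conv by metis
  \<comment> \<open>\<open>dir_cycle\<close> demands length at least 2; a closed walk of length 1
    would be a loop.\<close>
  have "n \<noteq> 1" using f(1) f(2)[of 0] assms(2) by auto
  then have n2: "n \<ge> 2" using n(1) by linarith
  have neq: "f i \<noteq> f j" if ij: "i < j" "j < n" for i j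
  proof
    assume "f i = f j"
    then have "(f i, f i) \<in> ?R ^^ (j - i)"
      unfolding relpow_fun_conv using f(2) ij by (intro exI[of _ "\<lambda>l. f (i + l)"]) auto
    then have "n \<le> j - i" using ij by (intro least) auto
    then show False using ij by simp
  qed
  have inj: "inj_on f {0..<n}"
    using neq by (intro inj_onI) (metis atLeastLessThan_iff linorder_neqE_nat)
  define cs where "cs = map f [0..<n]"
  have edge: "(cs ! i, cs ! ((i + 1) mod length cs)) \<in> ?R" if "i < length cs" for i
  proof (cases "i + 1 = n")
    case True
    then show ?thesis using f(2)[of i] f(1) n by (auto simp: cs_def)
  next
    case False
    then show ?thesis using f(2)[of i] that by (auto simp: cs_def)
  qed
  have "dir_cycle A cs"
    unfolding dir_cycle_def using edge n2 inj by (auto simp: cs_def distinct_map)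
  then show False using assms(1) edge unfolding feedback_arc_set_def by blast
qed

text \<open>The number of strict ancestors strictly increases along the edges of the acyclic
  relation A - F.\<close>

lemma feedback_linear_order:
  assumes "feedback_arc_set A F" "\<And>x. (x, x) \<notin> A" "finite V" "A \<subseteq> V \<times> V"
  obtains ord :: "'v \<Rightarrow> nat" where "inj_on ord V"
    "\<And>u v. (u, v) \<in> A \<Longrightarrow> (u, v) \<notin> F \<Longrightarrow> ord u < ord v"
proof -
  let ?R = "A - F"
  have acyc: "acyclic ?R" by (rule feedback_acyclic[OF assms(1,2)])
  have finA: "finite A" using assms(3,4) finite_subset by blast
  then have fin: "finite (?R\<^sup>+)" by simp
  define pred where "pred v = {u. (u, v) \<in> ?R\<^sup>+}" for v
  have "pred v \<subseteq> fst ` (?R\<^sup>+)" for v unfolding pred_def by force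
  then have finp: "finite (pred v)" for v using fin by (metis finite_imageI finite_subset)
  obtain idx :: "'v \<Rightarrow> nat" where idx: "bij_betw idx V {0..<card V}"
    using ex_bij_betw_finite_nat[OF assms(3)] by blast
  have idx_less: "idx v < card V" if "v \<in> V" for v
    using idx that by (auto simp: bij_betw_def)
  \<comment> \<open>The ancestor count is the leading digit in base \<open>card V\<close>, and an
    enumeration of V breaks ties; its value is recovered modulo \<open>card V\<close>, hence
    injectivity.\<close>
  define ord where "ord v = card (pred v) * card V + idx v" for v
  show thesis
  proof (rule that)
    show "inj_on ord V"
    proof (rule inj_onI)
      fix u v assume uv: "u \<in> V" "v \<in> V" "ord u = ord v"
      have "ord x mod card V = idx x" if "x \<in> V" for x
        unfolding ord_def using idx_less[OF that] by simp
      then have "idx u = idx v" using uv by metis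
      then show "u = v" using idx uv by (auto simp: bij_betw_def inj_on_def)
    qed
    fix u v assume e: "(u, v) \<in> A" "(u, v) \<notin> F"
    have "u \<in> pred v" "u \<notin> pred u" "pred u \<subseteq> pred v"
      using e acyc unfolding pred_def acyclic_def by (auto intro: trancl_into_trancl)
    then have "card (pred u) < card (pred v)" by (intro psubset_card_mono[OF finp]) auto
    then have "(card (pred u) + 1) * card V \<le> card (pred v) * card V"
      by (intro mult_right_mono) auto
    moreover have "idx u < card V" using e assms(4) by (intro idx_less) auto
    ultimately show "ord u < ord v" unfolding ord_def by simp
  qed
qed

section \<open>Cutting and listing sets along an order\<close>

lemma threshold_exists:
  fixes ord :: "'v \<Rightarrow> nat"
  assumes "finite X" "inj_on ord X" "a \<le> card X"
  shows "\<exists>t. card {x \<in> X. ord x < t} = a"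
  using assms(3)
proof (induction a)
  case 0
  then show ?case by (intro exI[of _ 0]) simp
next
  case (Suc a)
  then obtain t where t: "card {x \<in> X. ord x < t} = a" by auto
  let ?L = "{x \<in> X. ord x < t}"
  have "X - ?L \<noteq> {}"
  proof
    assume "X - ?L = {}"
    then have "card X \<le> card ?L" using assms(1) by (intro card_mono) auto
    then show False using t Suc.prems by simp
  qed
  then obtain x where x: "x \<in> X - ?L" "\<And>y. y \<in> X - ?L \<Longrightarrow> ord x \<le> ord y"
    using ex_has_least_nat[of "\<lambda>x. x \<in> X - ?L" _ ord] by blast
  have "{y \<in> X. ord y < Suc (ord x)} = insert x ?L"
  proof (intro equalityI subsetI)
    fix y assume y: "y \<in> {y \<in> X. ord y < Suc (ord x)}"
    show "y \<in> insert x ?L"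
    proof (cases "y \<in> ?L")
      case False
      then have "ord y = ord x" using y x(2)[of y] by auto
      then show ?thesis using y x(1) assms(2) by (auto simp: inj_on_def)
    qed auto
  qed (use x(1) in auto)
  moreover have "card (insert x ?L) = Suc a" using x(1) t assms(1) by auto
  ultimately show ?case by metis
qed

text \<open>Backward edges lead from later to earlier vertices, while
  \<open>has_disjoint_TTs\<close> wants edges from smaller to larger indices; hence a decreasing
  list.\<close>

lemma decreasing_enumeration:
  fixes ord :: "'v \<Rightarrow> nat"
  assumes "finite K" "card K = l" "inj_on ord K"
  shows "\<exists>f. bij_betw f {..<l} K \<and> (\<forall>i j. i < j \<longrightarrow> j < l \<longrightarrow> ord (f j) < ord (f i))"
  using assms
proof (induction l arbitrary: K)
  case 0
  then show ?case by (simp add: bij_betw_def)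
next
  case (Suc l)
  then have "K \<noteq> {}" by auto
  then obtain x where x: "x \<in> K" "\<And>y. y \<in> K \<Longrightarrow> ord x \<le> ord y"
    using ex_has_least_nat[of "\<lambda>x. x \<in> K" _ ord] by blast
  have "card (K - {x}) = l" "inj_on ord (K - {x})"
    using Suc.prems x(1) by (auto simp: inj_on_def)
  then obtain f where f: "bij_betw f {..<l} (K - {x})"
    "\<And>i j. i < j \<Longrightarrow> j < l \<Longrightarrow> ord (f j) < ord (f i)"
    using Suc.IH[of "K - {x}"] Suc.prems(1) by blast
  have fK: "f i \<in> K - {x}" if "i < l" for i using f(1) that by (auto simp: bij_betw_def)
  have xl: "ord x < ord (f i)" if "i < l" for i
  proof -
    have "ord x \<le> ord (f i)" using x(2) fK[OF that] by blast
    moreover have "ord x \<noteq> ord (f i)" using Suc.prems(3) x(1) fK[OF that] by (auto simp: inj_on_def)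
    ultimately show ?thesis by simp
  qed
  have "bij_betw (f(l := x)) {..<Suc l} K"
  proof -
    have "bij_betw (f(l := x)) {..<l} (K - {x})"
      using f(1) by (subst bij_betw_cong[of _ _ f]) auto
    moreover have "bij_betw (f(l := x)) {l} {x}" by (auto simp: bij_betw_def)
    ultimately have "bij_betw (f(l := x)) ({..<l} \<union> {l}) ((K - {x}) \<union> {x})"
      by (intro bij_betw_combine) auto
    moreover have "{..<l} \<union> {l} = {..<Suc l}" "(K - {x}) \<union> {x} = K" using x(1) by auto
    ultimately show ?thesis by simp
  qed
  moreover have "ord ((f(l := x)) j) < ord ((f(l := x)) i)" if "i < j" "j < Suc l" for i j
    using f(2)[of i j] xl[of i] that by (cases "j = l") auto
  ultimately show ?case by (intro exI[of _ "f(l := x)"] conjI allI impI)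
qed

section \<open>The upper bound\<close>

text \<open>A cycle leaves a vertex of maximal level by an edge that does not ascend. Edges inside a
  level are included, so a level function with ties can describe the order.\<close>

lemma feedback_arc_set_by_level:
  fixes lev :: "'v \<Rightarrow> nat"
  shows "feedback_arc_set A {(u, v) \<in> A. lev v \<le> lev u}"
  unfolding feedback_arc_set_def
proof (intro conjI allI impI)
  fix cs assume cs: "dir_cycle A cs"
  then have len: "length cs \<ge> 2" unfolding dir_cycle_def by simp
  have "finite {lev (cs ! i) |i. i < length cs}" by simp
  moreover have ne: "{lev (cs ! i) |i. i < length cs} \<noteq> {}" using len by (auto intro!: exI[of _ 0])
  ultimately have "Max {lev (cs ! i) |i. i < length cs} \<in> {lev (cs ! i) |i. i < length cs}" by (rule Max_in)
  then obtain i where i: "i < length cs" "lev (cs ! i) = Max {lev (cs ! i) |i. i < length cs}" by auto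
  have "(i + 1) mod length cs < length cs" using len by (intro mod_less_divisor) linarith
  then have "lev (cs ! ((i + 1) mod length cs)) \<le> lev (cs ! i)"
    unfolding i(2) by (intro Max_ge) auto
  then show "\<exists>i<length cs. (cs ! i, cs ! ((i + 1) mod length cs)) \<in> {(u, v) \<in> A. lev v \<le> lev u}"
    using cs i(1) unfolding dir_cycle_def by auto
qed auto

lemma disjoint_TTs_upper_bound:
  assumes A: "A \<in> kp_tournaments k n" and k: "k \<ge> 2"
    and all: "\<forall>F. feedback_arc_set A F \<longrightarrow> has_disjoint_TTs k F t"
  shows "t \<le> n (k - 1) - (k - 1)"
proof -
  \<comment> \<open>Vertex (k - 1, i) with i < k - 1 has no edge to class i in the resulting feedback arc set,
    so it lies in no k-clique of it.\<close>
  define lev :: "nat \<times> nat \<Rightarrow> nat" where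
    "lev w = (if fst w = k - 1 then 1 else if ((k - 1, fst w), w) \<in> A then 2 else 0)" for w
  define F where "F = {(u, v) \<in> A. lev v \<le> lev u}"
  have "has_disjoint_TTs k F t" using all feedback_arc_set_by_level unfolding F_def by blast
  then obtain c :: "nat \<Rightarrow> nat \<Rightarrow> nat \<times> nat" where
    inj: "inj_on (\<lambda>(a, j). c a j) ({..<t} \<times> {..<k})" and
    c: "\<And>a j j'. a < t \<Longrightarrow> j' < k \<Longrightarrow> j < j' \<Longrightarrow> (c a j, c a j') \<in> F"
    unfolding has_disjoint_TTs_def by (auto dest: less_trans)
  have adj: "(c a j, c a j') \<in> F \<or> (c a j', c a j) \<in> F" if "a < t" "j < k" "j' < k" "j \<noteq> j'" for a j j'
    using c[of a j j'] c[of a j' j] that by linarith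
  have FA: "F \<subseteq> A" unfolding F_def by auto
  have vert: "c a j \<in> kp_vertices k n" if "a < t" "j < k" for a j
  proof -
    \<comment> \<open>As k is at least 2, every member of a clique is an endpoint of an edge of A,
      and therefore a vertex of the graph.\<close>
    have "\<exists>j'. j' < k \<and> j' \<noteq> j" using k by (intro exI[of _ "if j = 0 then 1 else 0"]) auto
    then obtain j' where "j' < k" "j' \<noteq> j" by blast
    then show ?thesis using adj[of a j j'] that FA kp_tournamentD(1,2)[OF A] by blast
  qed
  \<comment> \<open>Adjacent vertices lie in different classes, so the k members of a clique meet
    each of the k classes.\<close>
  have surj: "\<exists>j<k. fst (c a j) = i" if a: "a < t" and i: "i < k" for a i
  proof -
    have "inj_on (\<lambda>j. fst (c a j)) {..<k}"
    proof (rule inj_onI)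
      fix j j' assume jj: "j \<in> {..<k}" "j' \<in> {..<k}" "fst (c a j) = fst (c a j')"
      show "j = j'"
      proof (rule ccontr)
        assume "j \<noteq> j'"
        then have "(c a j, c a j') \<in> A \<or> (c a j', c a j) \<in> A" using adj[OF a, of j j'] FA jj by blast
        then show False using kp_tournamentD(3)[OF A] jj(3) by metis
      qed
    qed
    moreover have "(\<lambda>j. fst (c a j)) ` {..<k} \<subseteq> {..<k}"
      using vert[OF a] by (auto simp: kp_vertices_def case_prod_unfold)
    ultimately have "(\<lambda>j. fst (c a j)) ` {..<k} = {..<k}" by (intro endo_inj_surj) auto
    then have "i \<in> (\<lambda>j. fst (c a j)) ` {..<k}" using i by simp
    then show ?thesis by auto
  qed
  have "\<exists>j. j < k \<and> fst (c a j) = k - 1" if "a < t" for a using surj[OF that, of "k - 1"] k by auto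
  then obtain q where q: "\<And>a. a < t \<Longrightarrow> q a < k \<and> fst (c a (q a)) = k - 1" by metis
  \<comment> \<open>The vertex (k - 1, i) has level 1. Its out-neighbours in class i have level 2
    and its in-neighbours there level 0, so both kinds of edges ascend.\<close>
  have no_edge: "((k - 1, i), w) \<notin> F" "(w, (k - 1, i)) \<notin> F" if "fst w = i" "i < k - 1" for w i
    using that kp_tournamentD(4)[OF A, of w "(k - 1, i)"] unfolding F_def lev_def by auto
  have "snd (c a (q a)) \<in> {k - 1..<n (k - 1)}" if a: "a < t" for a
  proof -
    have eq: "c a (q a) = (k - 1, snd (c a (q a)))" using q[OF a] by (metis prod.collapse)
    have "snd (c a (q a)) < n (k - 1)"
      using vert[OF a, of "q a"] q[OF a] by (auto simp: kp_vertices_def case_prod_unfold)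
    moreover have "\<not> snd (c a (q a)) < k - 1"
    proof
      assume less: "snd (c a (q a)) < k - 1"
      then have "snd (c a (q a)) < k" by simp
      then obtain j where j: "j < k" "fst (c a j) = snd (c a (q a))" using surj[OF a] by blast
      then have "j \<noteq> q a" using q[OF a] less by auto
      then have "(c a j, c a (q a)) \<in> F \<or> (c a (q a), c a j) \<in> F" using adj a j q[OF a] by blast
      then show False using no_edge[OF j(2) less] eq by metis
    qed
    ultimately show ?thesis by simp
  qed
  then have sub: "(\<lambda>a. snd (c a (q a))) ` {..<t} \<subseteq> {k - 1..<n (k - 1)}" by auto
  have "inj_on (\<lambda>a. snd (c a (q a))) {..<t}"
  proof (rule inj_onI)
    fix a b assume ab: "a \<in> {..<t}" "b \<in> {..<t}" "snd (c a (q a)) = snd (c b (q b))"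
    then have "c a (q a) = c b (q b)" using q by (simp add: prod_eq_iff)
    then have "(a, q a) = (b, q b)" using inj_onD[OF inj, of "(a, q a)" "(b, q b)"] ab q by auto
    then show "a = b" by simp
  qed
  then have "t = card ((\<lambda>a. snd (c a (q a))) ` {..<t})" by (simp add: card_image)
  also have "\<dots> \<le> card {k - 1..<n (k - 1)}" using sub by (intro card_mono) auto
  finally show ?thesis by simp
qed

section \<open>The lower bound\<close>

text \<open>Holes have size 2 * a because each side will be cut into halves of size a. Paths are
  counted up to 2 * d because two vertices with fewer than d backward edges each to a class share
  fewer than 2 * d paths through it. The summand k in the bound on d covers the k - 1 vertices
  deleted from a class, both in the degrees and in the class sizes.\<close>

lemma disjoint_TTs_lower_bound:
  assumes A: "A \<in> kp_tournaments k n" and k: "k \<ge> 2" and m: "\<And>i. i < k \<Longrightarrow> m \<le> n i"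
    and uni: "\<not> unidirectional k m a A" and paths: "\<not> few_paths k m (2 * d) A"
    and a: "a \<ge> 1" and d: "factor_threshold k (2 * a) + k \<le> d" and dm: "d \<le> m"
    and F: "feedback_arc_set A F"
  shows "has_disjoint_TTs k F (m - (k - 1))"
proof -
  have irr: "(x, x) \<notin> A" for x using kp_tournamentD(3)[OF A] by blast
  have AV: "A \<subseteq> kp_vertices k n \<times> kp_vertices k n" using kp_tournamentD(1,2)[OF A] by auto
  obtain ord :: "nat \<times> nat \<Rightarrow> nat" where inj: "inj_on ord (kp_vertices k n)"
    and ord: "\<And>u v. (u, v) \<in> A \<Longrightarrow> (u, v) \<notin> F \<Longrightarrow> ord u < ord v"
    by (rule feedback_linear_order[OF F irr finite_kp_vertices AV]) blast
  define B where "B x y \<longleftrightarrow> ((x, y) \<in> A \<and> ord y < ord x) \<or> ((y, x) \<in> A \<and> ord x < ord y)" for x y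
  define V where "V i = {i} \<times> {..<m}" for i :: nat
  have finV: "finite (V i)" "card (V i) = m" for i unfolding V_def by auto
  have VV: "V i \<subseteq> kp_vertices k n" if "i < k" for i
    using m[OF that] that unfolding V_def kp_vertices_def by auto
  define Bad where "Bad j = {u \<in> {..<k} \<times> {..<m}. fst u \<noteq> j \<and> card {w \<in> V j. B u w} < d}" for j
  have finBad: "finite (Bad j)" for j by (rule finite_subset[of _ "{..<k} \<times> {..<m}"]) (auto simp: Bad_def)
  \<comment> \<open>A vertex with few backward edges to class j splits class j nearly as its position in the
    order does, so two such vertices would have nearly nested out-neighbourhoods there.\<close>
  have Bad_ord: False if "j < k" "u \<in> Bad j" "v \<in> Bad j" "ord u < ord v" for j u v
  proof -
    let ?P = "{w \<in> {j} \<times> {..<m}. (v, w) \<in> A \<and> (w, u) \<in> A}"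
    have uv: "u \<in> {..<k} \<times> {..<m}" "v \<in> {..<k} \<times> {..<m}" "fst u \<noteq> j" "fst v \<noteq> j" "u \<noteq> v"
      using that unfolding Bad_def by auto
    \<comment> \<open>On a path from v over w to u, either w comes after u, and then its edge to u
      is backward, or w does not, and then it precedes v and the edge from v to w is
      backward.\<close>
    have "?P \<subseteq> {w \<in> V j. B u w} \<union> {w \<in> V j. B v w}"
    proof
      fix w assume w: "w \<in> ?P"
      show "w \<in> {w \<in> V j. B u w} \<union> {w \<in> V j. B v w}"
        using w that(4) by (cases "ord u < ord w") (auto simp: B_def V_def)
    qed
    then have "card ?P \<le> card ({w \<in> V j. B u w} \<union> {w \<in> V j. B v w})"
      using finV by (intro card_mono) auto
    also have "\<dots> \<le> card {w \<in> V j. B u w} + card {w \<in> V j. B v w}" by (rule card_Un_le)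
    also have "\<dots> < 2 * d" using that(2,3) unfolding Bad_def by auto
    finally show False using paths uv that(1) unfolding few_paths_def by blast
  qed
  have "x = y" if "j < k" "x \<in> Bad j" "y \<in> Bad j" for j x y
  proof (rule ccontr)
    assume "x \<noteq> y"
    have "x \<in> V (fst x)" "y \<in> V (fst y)" "fst x < k" "fst y < k"
      using that by (auto simp: Bad_def V_def)
    then have "x \<in> kp_vertices k n" "y \<in> kp_vertices k n" using VV by blast+
    then have "ord x \<noteq> ord y" using \<open>x \<noteq> y\<close> inj by (auto simp: inj_on_def)
    then show False using Bad_ord[OF that(1,2,3)] Bad_ord[OF that(1,3,2)] by linarith
  qed
  then have cBad: "card (Bad j) \<le> 1" if "j < k" for j
    using that finBad[of j] by (auto simp: card_le_Suc0_iff_eq)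
  \<comment> \<open>Each of the k - 1 other classes contributes at most one bad vertex to class i.
    The deleted set is padded to exactly k - 1 vertices so that the classes keep equal sizes, as a
    perfect tiling demands.\<close>
  have "\<exists>R. (\<Union>j\<in>{..<k}-{i}. Bad j \<inter> V i) \<subseteq> R \<and> R \<subseteq> V i \<and> card R = k - 1" if i: "i < k" for i
  proof (rule exists_subset_between)
    have "card (\<Union>j\<in>{..<k}-{i}. Bad j \<inter> V i) \<le> (\<Sum>j\<in>{..<k}-{i}. card (Bad j \<inter> V i))"
      by (rule card_UN_le) simp
    also have "\<dots> \<le> (\<Sum>j\<in>{..<k}-{i}. 1)"
    proof (rule sum_mono)
      fix j assume j: "j \<in> {..<k} - {i}"
      have "card (Bad j \<inter> V i) \<le> card (Bad j)" using finBad by (intro card_mono) auto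
      then show "card (Bad j \<inter> V i) \<le> 1" using cBad[of j] j by auto
    qed
    also have "\<dots> = k - 1" using i by simp
    finally show "card (\<Union>j\<in>{..<k}-{i}. Bad j \<inter> V i) \<le> k - 1" .
    show "k - 1 \<le> card (V i)" using finV d dm by simp
  qed (use finV in auto)
  then obtain R where R: "\<And>i. i < k \<Longrightarrow> (\<Union>j\<in>{..<k}-{i}. Bad j \<inter> V i) \<subseteq> R i"
    "\<And>i. i < k \<Longrightarrow> R i \<subseteq> V i" "\<And>i. i < k \<Longrightarrow> card (R i) = k - 1" by metis
  define U where "U i = V i - R i" for i
  have UV: "U i \<subseteq> V i" for i unfolding U_def by auto
  have finU: "finite (U i)" for i using UV finV finite_subset by blast
  have cU: "card (U i) = m - (k - 1)" if "i < k" for i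
    unfolding U_def using R(2,3)[OF that] finV by (subst card_Diff_subset) (auto intro: finite_subset)
  interpret G: holefree_multipartite k "2 * a" U B
  proof
    show "U i \<inter> U j = {}" if "i \<noteq> j" for i j
      using UV[of i] UV[of j] that unfolding V_def by auto
    show "\<exists>x\<in>X. \<exists>y\<in>Y. B x y"
      if ij: "i < k" "j < k" "i \<noteq> j" and X: "X \<subseteq> U i" "card X = 2 * a" and Y: "Y \<subseteq> U j" "card Y = 2 * a"
      for i j X Y
    proof (rule ccontr)
      assume no: "\<not> ?thesis"
      have XV: "X \<subseteq> V i" "Y \<subseteq> V j" using X Y UV by auto
      have fin: "finite X" "finite Y" using XV finV finite_subset by blast+
      have injX: "inj_on ord X" "inj_on ord Y"
        using XV VV ij by (meson inj inj_on_subset order_trans)+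
      \<comment> \<open>Cut both sides of the hole at their medians s and t. If s \<le> t, the lower
        half of X precedes the upper half of Y; otherwise the lower half of Y precedes the upper
        half of X. Without backward edges, all edges between these halves point the same
        way.\<close>
      obtain s where s: "card {x \<in> X. ord x < s} = a"
        using threshold_exists[OF fin(1) injX(1), of a] X by auto
      obtain t where t: "card {y \<in> Y. ord y < t} = a"
        using threshold_exists[OF fin(2) injX(2), of a] Y by auto
      have upper: "card {x \<in> S. \<not> ord x < r} = a" if "finite S" "card S = 2 * a" "card {x \<in> S. ord x < r} = a"
        for S r
      proof -
        have "{x \<in> S. \<not> ord x < r} = S - {x \<in> S. ord x < r}" by auto
        then show ?thesis using that by (simp add: card_Diff_subset)
      qed
      have oriented: False if ij: "i < k" "j < k" "i \<noteq> j" and X: "X \<subseteq> V i" and Y: "Y \<subseteq> V j"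
        and c: "card X = a" "card Y = a" and lt: "\<And>x y. x \<in> X \<Longrightarrow> y \<in> Y \<Longrightarrow> ord x < ord y"
        and no: "\<And>x y. x \<in> X \<Longrightarrow> y \<in> Y \<Longrightarrow> \<not> B x y" for i j X Y
      proof -
        have "(x, y) \<in> A" if xy: "x \<in> X" "y \<in> Y" for x y
        proof -
          have "x \<in> V i" "y \<in> V j" using xy X Y by auto
          then have "x \<in> kp_vertices k n" "y \<in> kp_vertices k n" "fst x \<noteq> fst y"
            using VV ij by (blast, blast, auto simp: V_def)
          then have "(x, y) \<in> A \<or> (y, x) \<in> A" by (rule kp_tournament_total[OF A])
          then show ?thesis using no[OF xy] lt[OF xy] unfolding B_def by blast
        qed
        then have "X \<times> Y \<subseteq> A" by auto
        then show False using uni ij X Y c unfolding unidirectional_def V_def by blast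
      qed
      have noB: "\<not> B x y" "\<not> B y x" if "x \<in> X" "y \<in> Y" for x y
        using no that unfolding B_def by blast+
      show False
      proof (cases "s \<le> t")
        case True
        show False
          by (rule oriented[of i j "{x \<in> X. ord x < s}" "{y \<in> Y. \<not> ord y < t}"])
            (use ij XV s upper[OF fin(2) Y(2) t] True noB in auto)
      next
        case False
        show False
          by (rule oriented[of j i "{y \<in> Y. ord y < t}" "{x \<in> X. \<not> ord x < s}"])
            (use ij XV t upper[OF fin(1) X(2) s] False noB in auto)
      qed
    qed
  qed (use k a finU in \<open>auto simp: B_def\<close>)
  have deg: "factor_threshold k (2 * a) \<le> card (G.nbrs x (U j))" if ij: "i < k" "j < k" "i \<noteq> j" and x: "x \<in> U i" for i j x
  proof -
    have "x \<notin> Bad j" using R(1)[of i] x ij unfolding U_def by auto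
    moreover have "x \<in> {..<k} \<times> {..<m}" "fst x \<noteq> j" using x UV[of i] ij unfolding V_def by auto
    ultimately have "d \<le> card {w \<in> V j. B x w}" unfolding Bad_def by auto
    moreover have "finite (R j)" using R(2)[of j] ij finV finite_subset by blast
    then have "card {w \<in> V j. B x w} - card (R j) \<le> card ({w \<in> V j. B x w} - R j)"
      by (rule diff_card_le_card_Diff)
    moreover have "{w \<in> V j. B x w} - R j = G.nbrs x (U j)" unfolding G.nbrs_def U_def by auto
    ultimately show ?thesis using d R(3)[OF ij(2)] by simp
  qed
  have "G.factorable G.verts"
    by (rule G.perfect_clique_factor[where M = "m - (k - 1)"]) (use deg cU d dm in auto)
  then obtain P where P: "G.clique_factor P G.verts" unfolding G.factorable_def by blast
  then have finP: "finite P" and disP: "disjoint P" and clP: "\<And>K. K \<in> P \<Longrightarrow> G.transversal_clique K"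
    unfolding G.clique_factor_def by auto
  \<comment> \<open>Class 0 serves to count the cliques, since each of them meets it exactly
    once.\<close>
  have "0 < k" using k by simp
  then have "G.verts \<inter> U 0 = U 0" using G.U_subset_verts[of 0] by blast
  moreover have "card (G.verts \<inter> U 0) = card P"
    using G.clique_factor_balanced[OF P] \<open>0 < k\<close> unfolding G.balanced_def by blast
  ultimately have "card P = m - (k - 1)" using cU[OF \<open>0 < k\<close>] by simp
  then obtain h where h: "bij_betw h {..<m - (k - 1)} P"
    using ex_bij_betw_nat_finite[OF finP] by (metis atLeast0LessThan)
  have "\<exists>f. bij_betw f {..<k} K \<and> (\<forall>i j. i < j \<longrightarrow> j < k \<longrightarrow> ord (f j) < ord (f i))" if K: "K \<in> P" for K
  proof -
    obtain f where f: "K = f ` {..<k}" "\<And>i. i < k \<Longrightarrow> f i \<in> U i"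
      using clP[OF K] unfolding G.transversal_clique_def by blast
    have "inj_on f {..<k}" using f(2) G.class_unique by (intro inj_onI) (metis lessThan_iff)
    then have "card K = k" "finite K" using f(1) by (auto simp: card_image)
    moreover have "K \<subseteq> kp_vertices k n" using f UV VV by blast
    then have "inj_on ord K" using inj inj_on_subset by blast
    ultimately show ?thesis by (intro decreasing_enumeration)
  qed
  then obtain f where f: "\<And>K. K \<in> P \<Longrightarrow> bij_betw (f K) {..<k} K"
    "\<And>K i j. K \<in> P \<Longrightarrow> i < j \<Longrightarrow> j < k \<Longrightarrow> ord (f K j) < ord (f K i)" by metis
  have hP: "h b \<in> P" if "b < m - (k - 1)" for b using h that by (auto simp: bij_betw_def)
  have fK: "f K j \<in> K" if "K \<in> P" "j < k" for K j using f(1)[OF that(1)] that(2) by (auto simp: bij_betw_def)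
  show ?thesis
    unfolding has_disjoint_TTs_def
  proof (intro exI[of _ "\<lambda>b j. f (h b) j"] conjI allI impI)
    show "inj_on (\<lambda>(b, j). f (h b) j) ({..<m - (k - 1)} \<times> {..<k})"
    proof (rule inj_onI)
      fix x y assume x: "x \<in> {..<m - (k - 1)} \<times> {..<k}" and y: "y \<in> {..<m - (k - 1)} \<times> {..<k}"
        and xy: "(case x of (b, j) \<Rightarrow> f (h b) j) = (case y of (b, j) \<Rightarrow> f (h b) j)"
      obtain b j b' j' where [simp]: "x = (b, j)" "y = (b', j')" by (cases x, cases y)
      have b: "b < m - (k - 1)" "j < k" "b' < m - (k - 1)" "j' < k" and eq: "f (h b) j = f (h b') j'"
        using x y xy by simp_all
      have "f (h b) j \<in> h b" "f (h b) j \<in> h b'" using fK hP b eq by (metis, metis)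
      then have "h b = h b'" using disP hP[OF b(1)] hP[OF b(3)] by (auto simp: disjoint_def)
      then have "b = b'" using h b by (auto simp: bij_betw_def inj_on_def)
      moreover have "j = j'" using eq b \<open>b = b'\<close> f(1)[OF hP[OF b(1)]] by (auto simp: bij_betw_def inj_on_def)
      ultimately show "x = y" by simp
    qed
    fix b j j' assume b: "b < m - (k - 1)" "j < k" "j' < k" "j < j'"
    let ?x = "f (h b) j" and ?y = "f (h b) j'"
    have lt: "ord ?y < ord ?x" using f(2) hP b by blast
    obtain g where g: "h b = g ` {..<k}" "\<And>i j. i < k \<Longrightarrow> j < k \<Longrightarrow> i \<noteq> j \<Longrightarrow> B (g i) (g j)"
      using clP[OF hP[OF b(1)]] unfolding G.transversal_clique_def by blast
    have "?x \<in> g ` {..<k}" "?y \<in> g ` {..<k}" using fK[OF hP[OF b(1)]] b g(1) by auto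
    then have "B ?x ?y" using g(2) lt by fastforce
    then have "(?x, ?y) \<in> A" using lt unfolding B_def by auto
    \<comment> \<open>Edges of A outside F go forward in \<open>ord\<close>, so this backward edge
      belongs to F.\<close>
    then show "(?x, ?y) \<in> F" using ord[of ?x ?y] lt by auto
  qed
qed

section \<open>Choice of parameters\<close>

text \<open>A pure power without a constant factor: for a \<ge> 2 constants can be moved into the
  exponent.\<close>

definition polynomially_bounded :: "(nat \<Rightarrow> nat) \<Rightarrow> bool" where
  "polynomially_bounded f \<longleftrightarrow> (\<exists>e. \<forall>a\<ge>2. f a \<le> a ^ e)"

lemma polynomially_bounded_const: "polynomially_bounded (\<lambda>a. c)"
  unfolding polynomially_bounded_def
proof (intro exI[of _ c] allI impI)
  fix a :: nat assume "a \<ge> 2"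
  have "c \<le> 2 ^ c" by (rule less_imp_le[OF less_exp])
  also have "\<dots> \<le> a ^ c" using \<open>a \<ge> 2\<close> by (rule power_mono) simp
  finally show "c \<le> a ^ c" .
qed

lemma polynomially_bounded_id: "polynomially_bounded (\<lambda>a. a)"
  unfolding polynomially_bounded_def by (intro exI[of _ 1]) auto

lemma polynomially_bounded_mult:
  assumes "polynomially_bounded f" "polynomially_bounded g"
  shows "polynomially_bounded (\<lambda>a. f a * g a)"
proof -
  obtain e e' where "\<And>a. a \<ge> 2 \<Longrightarrow> f a \<le> a ^ e" "\<And>a. a \<ge> 2 \<Longrightarrow> g a \<le> a ^ e'"
    using assms unfolding polynomially_bounded_def by blast
  then show ?thesis
    unfolding polynomially_bounded_def
    by (intro exI[of _ "e + e'"]) (auto simp: power_add intro: mult_mono)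
qed

lemma polynomially_bounded_power:
  "polynomially_bounded f \<Longrightarrow> polynomially_bounded (\<lambda>a. f a ^ j)"
  by (induction j) (auto intro: polynomially_bounded_const polynomially_bounded_mult)

lemma polynomially_bounded_add:
  assumes "polynomially_bounded f" "polynomially_bounded g"
  shows "polynomially_bounded (\<lambda>a. f a + g a)"
proof -
  obtain e e' where e: "\<And>a. a \<ge> 2 \<Longrightarrow> f a \<le> a ^ e" "\<And>a. a \<ge> 2 \<Longrightarrow> g a \<le> a ^ e'"
    using assms unfolding polynomially_bounded_def by blast
  have "f a + g a \<le> a ^ (e + e' + 1)" if a: "a \<ge> 2" for a
  proof -
    have "f a \<le> a ^ (e + e')" "g a \<le> a ^ (e + e')"
      using e[OF a] a power_increasing[of e "e + e'" a] power_increasing[of e' "e + e'" a] by linarith+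
    then have "f a + g a \<le> 2 * a ^ (e + e')" by simp
    also have "\<dots> \<le> a * a ^ (e + e')" using a by (rule mult_right_mono) simp
    finally show ?thesis by simp
  qed
  then show ?thesis unfolding polynomially_bounded_def by blast
qed

text \<open>This product is the space taken by 2 * d blocks of size a in
  \<open>prob_few_paths_le\<close>.\<close>

lemma polynomially_bounded_factor_threshold:
  "polynomially_bounded (\<lambda>a. 2 * (factor_threshold k (2 * a) + k) * a)"
  unfolding factor_threshold_def clique_threshold_def Let_def
  by (intro polynomially_bounded_add polynomially_bounded_mult polynomially_bounded_power
      polynomially_bounded_const polynomially_bounded_id)

text \<open>Used to choose a from m: the lower bound on m makes room for the thresholds, and the
  upper bound keeps the union bounds polynomial in a.\<close>

lemma integer_root_exists:
  assumes "e \<ge> 1" shows "\<exists>a::nat. a ^ e \<le> m \<and> m < (a + 1) ^ e"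
proof (induction m)
  case 0
  then show ?case using assms by (intro exI[of _ 0]) auto
next
  case (Suc m)
  then obtain a where a: "a ^ e \<le> m" "m < (a + 1) ^ e" by blast
  show ?case
  proof (cases "Suc m < (a + 1) ^ e")
    case True
    then show ?thesis using a by (intro exI[of _ a]) auto
  next
    case False
    then have "Suc m = (a + 1) ^ e" using a by simp
    then show ?thesis using assms by (intro exI[of _ "a + 1"]) (auto intro: power_strict_mono)
  qed
qed

text \<open>Split c into j + 1 equal factors r: one tames each of the j linear factors, and the last
  one still tends to 0.\<close>

lemma power_times_geometric_tendsto_0:
  fixes c :: real
  assumes "0 < c" "c < 1"
  shows "(\<lambda>a::nat. (real a + 1) ^ j * c ^ a) \<longlonglongrightarrow> 0"
proof -
  define r where "r = root (Suc j) c"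
  have r: "0 < r" "r < 1" "r ^ Suc j = c" using assms by (auto simp: r_def simp del: power_Suc)
  have "(\<lambda>a::nat. real (Suc a) * r ^ Suc a) \<longlonglongrightarrow> 0"
    by (rule LIMSEQ_Suc[OF powser_times_n_limit_0]) (use r in auto)
  then have "(\<lambda>a::nat. (real (Suc a) * r ^ Suc a) * (1 / r)) \<longlonglongrightarrow> 0 * (1 / r)"
    by (intro tendsto_intros)
  moreover have "(real (Suc a) * r ^ Suc a) * (1 / r) = (real a + 1) * r ^ a" for a
    using r(1) by simp
  ultimately have lim: "(\<lambda>a::nat. (real a + 1) * r ^ a) \<longlonglongrightarrow> 0" by simp
  have "(\<lambda>a::nat. ((real a + 1) * r ^ a) ^ j * r ^ a) \<longlonglongrightarrow> 0 ^ j * 0"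
    using r by (intro tendsto_mult tendsto_power lim LIMSEQ_power_zero) auto
  moreover have "((real a + 1) * r ^ a) ^ j * r ^ a = (real a + 1) ^ j * c ^ a" for a
    unfolding r(3)[symmetric] by (simp add: power_mult_distrib flip: power_mult power_add) (simp add: algebra_simps)
  ultimately show ?thesis by simp
qed

section \<open>Conclusion: choice of a and the total failure probability\<close>

theorem theorem1:
  fixes k :: nat
  assumes "k \<ge> 2"
  shows "\<forall>\<epsilon>>0. \<exists>N. \<forall>n :: nat \<Rightarrow> nat.
           (\<forall>i<k. 0 < n i) \<and> (\<forall>i<k. n (k - 1) \<le> n i) \<and> N \<le> n (k - 1) \<longrightarrow>
           measure_pmf.prob (random_kp_tournament k n)
             {A. int (f_TT k A) = int (n (k - 1)) - int k + 1} \<ge> 1 - \<epsilon>"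
proof (intro allI impI)
  fix \<epsilon> :: real assume \<epsilon>: "\<epsilon> > 0"
  define d where "d a = factor_threshold k (2 * a) + k" for a
  obtain e where e: "\<And>a. a \<ge> 2 \<Longrightarrow> 2 * d a * a \<le> a ^ e"
    using polynomially_bounded_factor_threshold[of k] unfolding polynomially_bounded_def d_def by blast
  have "e \<ge> 1"
  proof (rule ccontr)
    assume "\<not> e \<ge> 1"
    then have "e = 0" by simp
    then have "2 * d 2 * 2 \<le> 1" using e[of 2] by simp
    then show False using assms by (simp add: d_def)
  qed
  \<comment> \<open>The bound for \<open>unidirectional\<close> is an a-th power, m^(2a) / 2^(a^2) =
    (m^2 / 2^a)^a; it suffices that its base is below 1/2.\<close>
  have "eventually (\<lambda>a::nat. (real a + 1) ^ (2 * e) * (1 / 2) ^ a < 1 / 2) sequentially"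
    by (rule order_tendstoD(2)[OF power_times_geometric_tendsto_0]) auto
  moreover have "eventually (\<lambda>a::nat. (1 / 2 :: real) ^ a < \<epsilon> / (2 * real k ^ 2)) sequentially"
    by (rule order_tendstoD(2)[OF LIMSEQ_power_zero]) (use \<epsilon> assms in auto)
  moreover have "eventually (\<lambda>a::nat. (real a + 1) ^ (3 * e) * (3 / 4) ^ a < \<epsilon> / (2 * real k ^ 3)) sequentially"
    by (rule order_tendstoD(2)[OF power_times_geometric_tendsto_0]) (use \<epsilon> assms in auto)
  moreover have "eventually (\<lambda>a::nat. a \<ge> 2) sequentially" by (rule eventually_ge_at_top)
  ultimately have "eventually (\<lambda>a::nat. (real a + 1) ^ (2 * e) * (1 / 2) ^ a < 1 / 2 \<and>
      (1 / 2 :: real) ^ a < \<epsilon> / (2 * real k ^ 2) \<and>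
      (real a + 1) ^ (3 * e) * (3 / 4) ^ a < \<epsilon> / (2 * real k ^ 3) \<and> a \<ge> 2) sequentially"
    by eventually_elim auto
  then obtain a0 where a0: "\<And>a. a \<ge> a0 \<Longrightarrow> (real a + 1) ^ (2 * e) * (1 / 2) ^ a < 1 / 2"
    "\<And>a. a \<ge> a0 \<Longrightarrow> (1 / 2 :: real) ^ a < \<epsilon> / (2 * real k ^ 2)"
    "\<And>a. a \<ge> a0 \<Longrightarrow> (real a + 1) ^ (3 * e) * (3 / 4) ^ a < \<epsilon> / (2 * real k ^ 3)"
    "\<And>a. a \<ge> a0 \<Longrightarrow> a \<ge> 2"
    unfolding eventually_sequentially by blast
  show "\<exists>N. \<forall>n :: nat \<Rightarrow> nat.
           (\<forall>i<k. 0 < n i) \<and> (\<forall>i<k. n (k - 1) \<le> n i) \<and> N \<le> n (k - 1) \<longrightarrow>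
           measure_pmf.prob (random_kp_tournament k n)
             {A. int (f_TT k A) = int (n (k - 1)) - int k + 1} \<ge> 1 - \<epsilon>"
  \<comment> \<open>With this N, a0^e \<le> m < (a + 1)^e forces a \<ge> a0.\<close>
  proof (intro exI[of _ "a0 ^ e"] allI impI)
    fix n :: "nat \<Rightarrow> nat"
    assume n: "(\<forall>i<k. 0 < n i) \<and> (\<forall>i<k. n (k - 1) \<le> n i) \<and> a0 ^ e \<le> n (k - 1)"
    define m where "m = n (k - 1)"
    have mn: "m \<le> n i" if "i < k" for i using n that unfolding m_def by blast
    obtain a where a: "a ^ e \<le> m" "m < (a + 1) ^ e" using integer_root_exists[OF \<open>e \<ge> 1\<close>] by blast
    have "a0 ^ e < (a + 1) ^ e" using n a(2) unfolding m_def by linarith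
    then have "a0 < a + 1" by (rule power_less_imp_less_base) simp
    then have aa0: "a \<ge> a0" by simp
    then have a2: "a \<ge> 2" by (rule a0(4))
    have dm: "2 * d a * a \<le> m" "2 * d a \<le> m" "d a \<le> m"
    proof -
      show "2 * d a * a \<le> m" using e[OF a2] a(1) by linarith
      moreover have "2 * d a * 1 \<le> 2 * d a * a" using a2 by (intro mult_left_mono) auto
      ultimately show "2 * d a \<le> m" by linarith
      then show "d a \<le> m" by linarith
    qed
    let ?p = "random_kp_tournament k n"
    let ?good = "{A. int (f_TT k A) = int (n (k - 1)) - int k + 1}"
    have mr: "real m \<le> (real a + 1) ^ e"
      using a(2) by (metis less_imp_le of_nat_1 of_nat_add of_nat_le_iff of_nat_power)
    have p1: "measure_pmf.prob ?p {A. unidirectional k m a A} \<le> \<epsilon> / 2"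
    proof -
      have "measure_pmf.prob ?p {A. unidirectional k m a A}
          \<le> (real k ^ 2 * real m ^ (2 * a)) * (1 / 2 ^ (a * a))"
        by (rule prob_unidirectional_le[OF mn])
      also have "\<dots> \<le> (real k ^ 2 * ((real a + 1) ^ e) ^ (2 * a)) * (1 / 2 ^ (a * a))"
        using mr by (intro mult_right_mono mult_left_mono power_mono) auto
      also have "\<dots> = real k ^ 2 * ((real a + 1) ^ (2 * e) * (1 / 2) ^ a) ^ a"
        by (simp add: power_mult_distrib power_divide ac_simps flip: power_mult)
      also have "\<dots> \<le> real k ^ 2 * (1 / 2) ^ a"
        using a0(1)[OF aa0] by (intro mult_left_mono power_mono) auto
      also have "\<dots> \<le> real k ^ 2 * (\<epsilon> / (2 * real k ^ 2))"
        using a0(2)[OF aa0] by (intro mult_left_mono) auto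
      also have "\<dots> = \<epsilon> / 2" using assms by simp
      finally show ?thesis .
    qed
    have p2: "measure_pmf.prob ?p {A. few_paths k m (2 * d a) A} \<le> \<epsilon> / 2"
    proof -
      have "measure_pmf.prob ?p {A. few_paths k m (2 * d a) A}
          \<le> (real k ^ 3 * real m ^ 2 * real (2 * d a)) * (3 / 4) ^ a"
        by (rule prob_few_paths_le[OF mn dm(1)])
      \<comment> \<open>Of the three factors (a + 1)^e, two bound the choices of u and v and one the
        number 2 * d of blocks.\<close>
      also have "\<dots> \<le> (real k ^ 3 * ((real a + 1) ^ e) ^ 2 * (real a + 1) ^ e) * (3 / 4) ^ a"
        using mr dm(2) by (intro mult_right_mono mult_mono power_mono) auto
      also have "\<dots> = real k ^ 3 * ((real a + 1) ^ (3 * e) * (3 / 4) ^ a)"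
        by (simp add: ac_simps flip: power_mult power_add)
      also have "\<dots> \<le> real k ^ 3 * (\<epsilon> / (2 * real k ^ 3))"
        using a0(3)[OF aa0] by (intro mult_left_mono) auto
      also have "\<dots> = \<epsilon> / 2" using assms by simp
      finally show ?thesis .
    qed
    have good: "A \<in> ?good" if A: "A \<in> kp_tournaments k n"
      and u: "\<not> unidirectional k m a A" and f: "\<not> few_paths k m (2 * d a) A" for A
    proof -
      \<comment> \<open>This makes the truncated difference m - (k - 1) agree with the integer in
        the claim.\<close>
      have km: "k \<le> m" using dm(3) unfolding d_def by linarith
      have "f_TT k A = m - (k - 1)"
        unfolding f_TT_def
      proof (rule Greatest_equality)
        show "\<forall>F. feedback_arc_set A F \<longrightarrow> has_disjoint_TTs k F (m - (k - 1))"
          using disjoint_TTs_lower_bound[OF A assms mn u f _ _ dm(3)] a2 unfolding d_def by auto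
        fix t assume "\<forall>F. feedback_arc_set A F \<longrightarrow> has_disjoint_TTs k F t"
        then show "t \<le> m - (k - 1)"
          unfolding m_def by (rule disjoint_TTs_upper_bound[OF A assms])
      qed
      then show ?thesis using km assms unfolding m_def by (simp add: of_nat_diff)
    qed
    have "measure_pmf.prob ?p (- ?good) \<le>
        measure_pmf.prob ?p ({A. unidirectional k m a A} \<union> {A. few_paths k m (2 * d a) A})"
    \<comment> \<open>The inclusion holds only for actual tournaments, that is on the support of the
      distribution; hence monotonicity almost everywhere.\<close>
    proof (rule measure_pmf.finite_measure_mono_AE)
      have "set_pmf ?p = kp_tournaments k n"
        unfolding random_kp_tournament_def
        by (rule set_pmf_of_set[OF kp_tournaments_nonempty finite_kp_tournaments])
      then show "AE A in measure_pmf ?p. A \<in> - ?good \<longrightarrow>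
          A \<in> {A. unidirectional k m a A} \<union> {A. few_paths k m (2 * d a) A}"
        using good by (auto simp: AE_measure_pmf_iff)
    qed auto
    also have "\<dots> \<le> measure_pmf.prob ?p {A. unidirectional k m a A} +
        measure_pmf.prob ?p {A. few_paths k m (2 * d a) A}"
      by (rule measure_Un_le) auto
    also have "\<dots> \<le> \<epsilon>" using p1 p2 by simp
    finally have "measure_pmf.prob ?p (- ?good) \<le> \<epsilon>" .
    moreover have "measure_pmf.prob ?p (- ?good) = 1 - measure_pmf.prob ?p ?good"
      using measure_pmf.prob_compl[of ?good ?p] by (simp add: Compl_eq_Diff_UNIV)
    ultimately show "measure_pmf.prob ?p ?good \<ge> 1 - \<epsilon>" by simp
  qed
qed

end
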